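(* Let $T>0$, let $b<b'<c'<c$, and let $g\in C^1([0,L])$ satisfy $g'(0)=g'(L)=0$ and $g(x)\in(b',c')$ for all $x\in[0,L]$. Let $\overline u\in C^2([0,L]\times[0,T))\cap C([0,L]\times[0,T])$ be the unique solution, with values in $(b',c')$, of the (well-posed) final value problem $$u_t=\phi(u)_{xx}\ \text{ in }(0,L)\times(0,T),\qquad u_x(0,t)=u_x(L,t)=0\ \text{ for }t\in(0,T),\qquad u(x,T)=g(x)\ \text{ for }x\in(0,L),$$ and put $u_0(x):=\overline u(x,0)$. Then there exists $\overline T\in(0,T]$ such that the initial value problem $$u_t=\phi(u)_{xx}\ \text{ in }(0,L)\times(0,\overline T),\qquad \phi(u)_x(0,t)=\phi(u)_x(L,t)=0\ \text{ for }t\in(0,\overline T),\qquad u(x,0)=u_0(x)\ \text{ for }x\in(0,L),$$ has infinitely many pairwise different two-phase, measure-valued, regular solutions $(u,\lambda,v)$ in $Q_{\overline T}$ with $\lambda(\cdot,0)\equiv 0$, one of which is $(\overline u,0,\phi(\overline u))$, and for each of them $u$, $v$, $\lambda_0:=1-\lambda$, $\lambda_1:=0$, $\lambda_2:=\lambda$ form an entropy solution of the problem in $Q_{\overline T}$. In particular, entropy solutions $(u,\lambda_0,\lambda_1,\lambda_2,v)$ are not unique for such initial data.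
   Context: Let $L>0$, $\Omega=(0,L)$, and $Q_\tau=(0,L)\times(0,\tau)$ for $\tau>0$. Let $b<c$ be real numbers, $\alpha_1,\alpha_2>0$, $\gamma_1,\gamma_2\in\mathbb{R}$, $\phi_i(u)=\alpha_i u+\gamma_i$ for $i=1,2$, and suppose $A:=\phi_2(c)<B:=\phi_1(b)$. Let $\phi_0(u)=\frac{A(u-b)-B(u-c)}{c-b}$. The continuous, piecewise linear, nonmonotone function $\phi:\mathbb{R}\to\mathbb{R}$ is $\phi=\phi_1$ on $(-\infty,b]$, $\phi=\phi_0$ on $(b,c)$, $\phi=\phi_2$ on $[c,\infty)$. Let $\beta_1,\beta_0,\beta_2$ be the inverse functions of the branches $\phi_1,\phi_0,\phi_2$, defined on $(-\infty,B)$, $(A,B)$, $(A,\infty)$ respectively and extended continuously to the finite endpoints. In a sum of the form $\sum_i\lambda_i\beta_i(v)$ or $\sum_i\lambda_iG(\beta_i(v))$, a term whose coefficient is $0$ is understood to be $0$. For $\tau>0$ consider the problem (P): $u_t=\phi(u)_{xx}$ in $Q_\tau$, $\phi(u)_x(0,t)=\phi(u)_x(L,t)=0$ for $t\in(0,\tau)$, $u(x,0)=u_0(x)$ in $\Omega$. Entropy solution: an entropy solution of (P) in $Q_\tau$ is given by $u,\lambda_0,\lambda_1,\lambda_2\in L^\infty(Q_\tau)$ and $v\in L^\infty(Q_\tau)\cap L^2((0,\tau),H^1(\Omega))$ such that: (a) $\lambda_i\ge0$, $\sum_{i=0}^2\lambda_i=1$, $u=\sum_{i=0}^2\lambda_i\beta_i(v)$,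 with $\lambda_1=1$ if $v<A$ and $\lambda_2=1$ if $v>B$; (b) $\iint_{Q_\tau}\{u\psi_t-v_x\psi_x\}\,dx\,dt+\int_\Omega u_0(x)\psi(x,0)\,dx=0$ for every $\psi\in C^1(\overline{Q}_\tau)$ with $\psi(\cdot,\tau)=0$ in $\overline\Omega$; (c) for every $g\in C^1(\mathbb{R})$ with $g'\ge0$ and every $\psi\in C_0^\infty(Q_\tau)$ with $\psi\ge0$, $$\iint_{Q_\tau}\{G^*\psi_t-g(v)v_x\psi_x-g'(v)|v_x|^2\psi\}\,dx\,dt\ge0,$$ where $G(u)=\int_0^u g(\phi(s))\,ds+K$ ($K\in\mathbb{R}$) and $G^*(x,t)=\sum_{i=0}^2\lambda_i(x,t)G(\beta_i(v(x,t)))$. Two-phase, measure-valued, regular solution: a triple $u\in C^2(Q_\tau)\cap C((0,L)\times[0,\tau))$, $\lambda\in C^1(Q_\tau)\cap C((0,L)\times[0,\tau))$, $v\in C^2(Q_\tau)$ is a two-phase, measure-valued, regular solution of (P) in $Q_\tau$ if: (i) $u(x,0)=u_0(x)$ for every $x\in(0,L)$; (ii) $\lim_{x\to0^+}v_x(x,t)=\lim_{x\to L^-}v_x(x,t)=0$ for every $t\in(0,\tau)$; (iii) $v\ge A$, and $\lambda=1$ where $v>B$; (iv) $u=(1-\lambda)\beta_0(v)+\lambda\beta_2(v)$ and $u_t=v_{xx}$ in $Q_\tau$; (v) $\lambda_t\ge0$ and $0\le\lambda\le1$ in $Q_\tau$. *)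

theory Defs
  imports "HOL-Analysis.Analysis"
begin

(* Functions of (x,t) are total functions on real \<times> real; only their values on the
   sets mentioned in a definition are relevant. *)

definition Q :: "real \<Rightarrow> real \<Rightarrow> (real \<times> real) set" where
  "Q L \<tau> = {0<..<L} \<times> {0<..<\<tau>}"

(* Class C^k on S, meant for open sets and for convex sets with nonempty interior (where
   derivatives within S are unique).  At boundary points belonging to S the derivatives are
   one-sided, so C_on k S is C^k up to that part of the boundary. *)
primrec C_on :: "nat \<Rightarrow> 'a::euclidean_space set \<Rightarrow> ('a \<Rightarrow> real) \<Rightarrow> bool" where
  "C_on 0 S f \<longleftrightarrow> continuous_on S f"
| "C_on (Suc k) S f \<longleftrightarrow>
     (\<exists>D. (\<forall>x\<in>S. (f has_derivative D x) (at x within S)) \<and>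
          (\<forall>i\<in>Basis. C_on k S (\<lambda>x. D x i)))"

(* C_0^\<infinity>(S), S open *)
definition test_function :: "'a::euclidean_space set \<Rightarrow> ('a \<Rightarrow> real) \<Rightarrow> bool" where
  "test_function S \<psi> \<longleftrightarrow>
     (\<forall>k. C_on k UNIV \<psi>) \<and> compact (closure {x. \<psi> x \<noteq> 0}) \<and> closure {x. \<psi> x \<noteq> 0} \<subseteq> S"

definition dx :: "(real \<times> real \<Rightarrow> real) \<Rightarrow> real \<times> real \<Rightarrow> real" where
  "dx f p = deriv (\<lambda>x. f (x, snd p)) (fst p)"

definition dt :: "(real \<times> real \<Rightarrow> real) \<Rightarrow> real \<times> real \<Rightarrow> real" where
  "dt f p = deriv (\<lambda>t. f (fst p, t)) (snd p)"

definition L_infinity :: "(real \<times> real) set \<Rightarrow> (real \<times> real \<Rightarrow> real) \<Rightarrow> bool" where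
  "L_infinity S f \<longleftrightarrow>
     f \<in> borel_measurable (lebesgue_on S) \<and> (\<exists>C. AE p in lebesgue_on S. \<bar>f p\<bar> \<le> C)"

definition L2 :: "'a::euclidean_space set \<Rightarrow> ('a \<Rightarrow> real) \<Rightarrow> bool" where
  "L2 S f \<longleftrightarrow> f \<in> borel_measurable (lebesgue_on S) \<and> integrable (lebesgue_on S) (\<lambda>x. (f x)\<^sup>2)"

(* f belongs to H^1(0,L), with weak derivative h *)
definition H1_with_deriv :: "real \<Rightarrow> (real \<Rightarrow> real) \<Rightarrow> (real \<Rightarrow> real) \<Rightarrow> bool" where
  "H1_with_deriv L f h \<longleftrightarrow>
     L2 {0<..<L} f \<and> L2 {0<..<L} h \<and>
     (\<forall>\<zeta>. test_function {0<..<L} \<zeta> \<longrightarrow>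
        (LINT x|lebesgue_on {0<..<L}. f x * deriv \<zeta> x) =
        - (LINT x|lebesgue_on {0<..<L}. h x * \<zeta> x))"

(* v belongs to L^2((0,\<tau>),H^1(0,L)), with weak x-derivative vx.  H^1(0,L) is separable, so
   strong measurability of t \<mapsto> v(\<cdot>,t) amounts to joint measurability of v and vx, and
   the squared norm is the integral of v^2 + vx^2 over Q L \<tau>. *)
definition L2_H1_with_deriv ::
  "real \<Rightarrow> real \<Rightarrow> (real \<times> real \<Rightarrow> real) \<Rightarrow> (real \<times> real \<Rightarrow> real) \<Rightarrow> bool" where
  "L2_H1_with_deriv L \<tau> v vx \<longleftrightarrow>
     L2 (Q L \<tau>) v \<and> L2 (Q L \<tau>) vx \<and>
     (AE t in lebesgue_on {0<..<\<tau>}. H1_with_deriv L (\<lambda>x. v (x, t)) (\<lambda>x. vx (x, t)))"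

(* The data b, c, \<alpha>_1, \<alpha>_2, \<gamma>_1, \<gamma>_2 determining \<phi> *)
record nonlinearity =
  turn_b :: real
  turn_c :: real
  slope1 :: real
  slope2 :: real
  offset1 :: real
  offset2 :: real

definition phi1 :: "nonlinearity \<Rightarrow> real \<Rightarrow> real" where
  "phi1 N u = slope1 N * u + offset1 N"

definition phi2 :: "nonlinearity \<Rightarrow> real \<Rightarrow> real" where
  "phi2 N u = slope2 N * u + offset2 N"

definition level_A :: "nonlinearity \<Rightarrow> real" where
  "level_A N = phi2 N (turn_c N)"

definition level_B :: "nonlinearity \<Rightarrow> real" where
  "level_B N = phi1 N (turn_b N)"

definition phi0 :: "nonlinearity \<Rightarrow> real \<Rightarrow> real" where
  "phi0 N u = (level_A N * (u - turn_b N) - level_B N * (u - turn_c N)) / (turn_c N - turn_b N)"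

definition phi :: "nonlinearity \<Rightarrow> real \<Rightarrow> real" where
  "phi N u = (if u \<le> turn_b N then phi1 N u else if u < turn_c N then phi0 N u else phi2 N u)"

definition admissible :: "nonlinearity \<Rightarrow> bool" where
  "admissible N \<longleftrightarrow>
     turn_b N < turn_c N \<and> 0 < slope1 N \<and> 0 < slope2 N \<and> level_A N < level_B N"

(* Inverses of the closed branches, i.e. continuously extended to the finite endpoints of
   their domains {..B}, {A..B}, {A..}.  Elsewhere the values are irrelevant: there they only
   occur with coefficient 0. *)
definition beta1 :: "nonlinearity \<Rightarrow> real \<Rightarrow> real" where
  "beta1 N = the_inv_into {..turn_b N} (phi1 N)"

definition beta0 :: "nonlinearity \<Rightarrow> real \<Rightarrow> real" where
  "beta0 N = the_inv_into {turn_b N..turn_c N} (phi0 N)"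

definition beta2 :: "nonlinearity \<Rightarrow> real \<Rightarrow> real" where
  "beta2 N = the_inv_into {turn_c N..} (phi2 N)"

definition entropy_G :: "nonlinearity \<Rightarrow> (real \<Rightarrow> real) \<Rightarrow> real \<Rightarrow> real \<Rightarrow> real" where
  "entropy_G N g K u = (LBINT s=ereal 0..ereal u. g (phi N s)) + K"

definition entropy_G_star ::
  "nonlinearity \<Rightarrow> (real \<Rightarrow> real) \<Rightarrow> real \<Rightarrow> (real \<times> real \<Rightarrow> real) \<Rightarrow> (real \<times> real \<Rightarrow> real) \<Rightarrow>
     (real \<times> real \<Rightarrow> real) \<Rightarrow> (real \<times> real \<Rightarrow> real) \<Rightarrow> real \<times> real \<Rightarrow> real" where
  "entropy_G_star N g K l0 l1 l2 v p =
     l0 p * entropy_G N g K (beta0 N (v p)) +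
     l1 p * entropy_G N g K (beta1 N (v p)) +
     l2 p * entropy_G N g K (beta2 N (v p))"

(* vx is the weak derivative v_x; it is unique up to null sets. *)
definition entropy_solution ::
  "nonlinearity \<Rightarrow> real \<Rightarrow> real \<Rightarrow> (real \<Rightarrow> real) \<Rightarrow> (real \<times> real \<Rightarrow> real) \<Rightarrow> (real \<times> real \<Rightarrow> real) \<Rightarrow>
     (real \<times> real \<Rightarrow> real) \<Rightarrow> (real \<times> real \<Rightarrow> real) \<Rightarrow> (real \<times> real \<Rightarrow> real) \<Rightarrow> bool" where
  "entropy_solution N L \<tau> u0 u l0 l1 l2 v \<longleftrightarrow>
     L_infinity (Q L \<tau>) u \<and> L_infinity (Q L \<tau>) l0 \<and> L_infinity (Q L \<tau>) l1 \<and>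
     L_infinity (Q L \<tau>) l2 \<and> L_infinity (Q L \<tau>) v \<and>
     (AE p in lebesgue_on (Q L \<tau>).
        0 \<le> l0 p \<and> 0 \<le> l1 p \<and> 0 \<le> l2 p \<and> l0 p + l1 p + l2 p = 1 \<and>
        u p = l0 p * beta0 N (v p) + l1 p * beta1 N (v p) + l2 p * beta2 N (v p) \<and>
        (v p < level_A N \<longrightarrow> l1 p = 1) \<and> (v p > level_B N \<longrightarrow> l2 p = 1)) \<and>
     (\<exists>vx. L2_H1_with_deriv L \<tau> v vx \<and>
        (\<forall>\<psi>. C_on 1 ({0..L} \<times> {0..\<tau>}) \<psi> \<and> (\<forall>x\<in>{0..L}. \<psi> (x, \<tau>) = 0) \<longrightarrow>
           (LINT p|lebesgue_on (Q L \<tau>). u p * dt \<psi> p - vx p * dx \<psi> p) +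
           (LINT x|lebesgue_on {0<..<L}. u0 x * \<psi> (x, 0)) = 0) \<and>
        (\<forall>g K \<psi>. C_on 1 UNIV g \<and> (\<forall>s. 0 \<le> deriv g s) \<and>
             test_function (Q L \<tau>) \<psi> \<and> (\<forall>p. 0 \<le> \<psi> p) \<longrightarrow>
           0 \<le> (LINT p|lebesgue_on (Q L \<tau>).
                  entropy_G_star N g K l0 l1 l2 v p * dt \<psi> p
                  - g (v p) * vx p * dx \<psi> p
                  - deriv g (v p) * (vx p)\<^sup>2 * \<psi> p)))"

definition two_phase_regular_solution ::
  "nonlinearity \<Rightarrow> real \<Rightarrow> real \<Rightarrow> (real \<Rightarrow> real) \<Rightarrow>
     (real \<times> real \<Rightarrow> real) \<Rightarrow> (real \<times> real \<Rightarrow> real) \<Rightarrow> (real \<times> real \<Rightarrow> real) \<Rightarrow> bool" where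
  "two_phase_regular_solution N L \<tau> u0 u l v \<longleftrightarrow>
     C_on 2 (Q L \<tau>) u \<and> continuous_on ({0<..<L} \<times> {0..<\<tau>}) u \<and>
     C_on 1 (Q L \<tau>) l \<and> continuous_on ({0<..<L} \<times> {0..<\<tau>}) l \<and>
     C_on 2 (Q L \<tau>) v \<and>
     (\<forall>x\<in>{0<..<L}. u (x, 0) = u0 x) \<and>
     (\<forall>t\<in>{0<..<\<tau>}. ((\<lambda>x. dx v (x, t)) \<longlongrightarrow> 0) (at_right 0) \<and>
                   ((\<lambda>x. dx v (x, t)) \<longlongrightarrow> 0) (at_left L)) \<and>
     (\<forall>p\<in>Q L \<tau>. level_A N \<le> v p \<and> (v p > level_B N \<longrightarrow> l p = 1)) \<and>
     (\<forall>p\<in>Q L \<tau>. u p = (1 - l p) * beta0 N (v p) + l p * beta2 N (v p) \<and>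
                 dt u p = dx (dx v) p) \<and>
     (\<forall>p\<in>Q L \<tau>. 0 \<le> dt l p \<and> 0 \<le> l p \<and> l p \<le> 1)"

definition final_value_solution ::
  "nonlinearity \<Rightarrow> real \<Rightarrow> real \<Rightarrow> (real \<Rightarrow> real) \<Rightarrow> (real \<times> real \<Rightarrow> real) \<Rightarrow> bool" where
  "final_value_solution N L T g u \<longleftrightarrow>
     C_on 2 ({0..L} \<times> {0..<T}) u \<and> continuous_on ({0..L} \<times> {0..T}) u \<and>
     (\<forall>p\<in>Q L T. dt u p = dx (dx (\<lambda>q. phi N (u q))) p) \<and>
     (\<forall>t\<in>{0<..<T}. ((\<lambda>x. u (x, t)) has_real_derivative 0) (at 0 within {0..L}) \<and>
                   ((\<lambda>x. u (x, t)) has_real_derivative 0) (at L within {0..L})) \<and>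
     (\<forall>x\<in>{0<..<L}. u (x, T) = g x)"

end

theory Submission
  imports Defs
begin

text \<open>
  The unstable phase may leak into the stable one without changing \<open>u\<close>.  Keep
  \<open>u = ubar\<close> and raise the flux to \<open>v = \<phi>(ubar) + \<epsilon> t\<close>; as the added term does not depend on
  \<open>x\<close>, both \<open>u\<^sub>t = v\<^sub>x\<^sub>x\<close> and the Neumann conditions persist.  Splitting \<open>u\<close> between
  \<open>\<beta>\<^sub>0(v)\<close> and \<open>\<beta>\<^sub>2(v)\<close> determines \<open>\<lambda>\<close>: with \<open>\<kappa> = (c - b) / (B - A)\<close>, so that \<open>\<beta>\<^sub>0\<close> has slope
  \<open>-\<kappa>\<close>, it is \<open>\<kappa> \<epsilon> t / (\<beta>\<^sub>2(v) - \<beta>\<^sub>0(v))\<close>, which is nondecreasing in \<open>t\<close> for small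
  times because \<open>ubar\<^sub>t\<close> is bounded.  Each \<open>\<epsilon> \<in> [0,1]\<close> gives a different solution.

  The entropy production is
  \<open>g(v) v\<^sub>x\<^sub>x - (G\<^sup>*)\<^sub>t = \<lambda>\<^sub>t \<integral> (g(v) - g(\<phi>(s))) ds\<close> over \<open>s\<close> from \<open>\<beta>\<^sub>0(v)\<close> to \<open>\<beta>\<^sub>2(v)\<close>, and it
  is nonnegative because \<open>\<phi> \<le> v\<close> on that interval.
\<close>

subsection \<open>Functions of class \<open>C\<^sup>k\<close>\<close>

text \<open>Derivatives in \<open>C_on\<close> are taken within \<open>S\<close>, so values off
  \<open>S\<close> never enter and the same \<open>D\<close> serves both functions, even at boundary
  points. This lets \<open>phi\<close> be replaced by an affine formula on a closed
  rectangle.\<close>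

lemma C_on_cong:
  assumes "\<And>x. x \<in> S \<Longrightarrow> f x = h x" and "C_on k S f"
  shows "C_on k S h"
proof (cases k)
  case 0
  then show ?thesis using assms continuous_on_cong by fastforce
next
  case (Suc m)
  have "(h has_derivative D) (at x within S)" if "(f has_derivative D) (at x within S)" "x \<in> S" for D x
    using has_derivative_transform[OF that(2) _ that(1)] assms(1) by simp
  then show ?thesis using assms(2) Suc by auto
qed

lemma C_on_subset: "C_on k S f \<Longrightarrow> S' \<subseteq> S \<Longrightarrow> C_on k S' f"
proof (induction k arbitrary: f)
  case 0
  then show ?case using continuous_on_subset by auto
next
  case (Suc k)
  then obtain D where "\<forall>x\<in>S. (f has_derivative D x) (at x within S)"
      "\<forall>i\<in>Basis. C_on k S (\<lambda>x. D x i)" by auto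
  then show ?case using Suc has_derivative_subset[of f _ _ S S'] by (auto intro!: exI[of _ D])
qed

lemma C_on_SucD: "C_on (Suc k) S f \<Longrightarrow> C_on k S f"
proof (induction k arbitrary: f)
  case 0
  then show ?case by (auto intro: has_derivative_continuous_on)
next
  case (Suc k)
  then obtain D where "\<forall>x\<in>S. (f has_derivative D x) (at x within S)"
      "\<forall>i\<in>Basis. C_on (Suc k) S (\<lambda>x. D x i)" by (auto simp del: C_on.simps(2) simp: C_on.simps(2)[of "Suc k"])
  then show ?case using Suc.IH by auto
qed

lemma C_on_const [simp]: "C_on k S (\<lambda>x. a)"
proof (induction k arbitrary: a)
  case (Suc k)
  then show ?case by (auto intro!: exI[of _ "\<lambda>x y. 0"])
qed simp

lemma C_on_bounded_linear: "bounded_linear f \<Longrightarrow> C_on k S f"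
  by (cases k) (auto intro!: exI[of _ "\<lambda>x. f"] bounded_linear_imp_has_derivative linear_continuous_on)

lemma C_on_add: "C_on k S f \<Longrightarrow> C_on k S h \<Longrightarrow> C_on k S (\<lambda>x. f x + h x)"
proof (induction k arbitrary: f h)
  case 0
  then show ?case by (auto intro: continuous_intros)
next
  case (Suc k)
  then obtain D E where "\<forall>x\<in>S. (f has_derivative D x) (at x within S)"
      "\<forall>i\<in>Basis. C_on k S (\<lambda>x. D x i)" "\<forall>x\<in>S. (h has_derivative E x) (at x within S)"
      "\<forall>i\<in>Basis. C_on k S (\<lambda>x. E x i)" by auto
  then show ?case using Suc.IH
    by (auto intro!: exI[of _ "\<lambda>x i. D x i + E x i"] has_derivative_add)
qed

lemma C_on_mult: "C_on k S f \<Longrightarrow> C_on k S h \<Longrightarrow> C_on k S (\<lambda>x. f x * h x)"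
proof (induction k arbitrary: f h)
  case 0
  then show ?case by (auto intro: continuous_intros)
next
  case (Suc k)
  then obtain D E where D: "\<forall>x\<in>S. (f has_derivative D x) (at x within S)"
      "\<forall>i\<in>Basis. C_on k S (\<lambda>x. D x i)" "\<forall>x\<in>S. (h has_derivative E x) (at x within S)"
      "\<forall>i\<in>Basis. C_on k S (\<lambda>x. E x i)" by auto
  \<comment> \<open>The product rule mixes the factors with their derivatives, so the induction
    hypothesis also has to apply to \<open>f\<close> and \<open>h\<close> themselves, one class
    lower.\<close>
  have "C_on k S f" "C_on k S h" using Suc.prems C_on_SucD by blast+
  then show ?case using Suc.IH D
    by (auto intro!: exI[of _ "\<lambda>x i. f x * E x i + D x i * h x"] has_derivative_mult C_on_add)
qed

lemma C_on_inverse: "C_on k S f \<Longrightarrow> (\<And>x. x \<in> S \<Longrightarrow> f x \<noteq> 0) \<Longrightarrow> C_on k S (\<lambda>x. inverse (f x))"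
proof (induction k)
  case 0
  then show ?case by (auto intro: continuous_intros)
next
  case (Suc k)
  then obtain D where D: "\<forall>x\<in>S. (f has_derivative D x) (at x within S)"
      "\<forall>i\<in>Basis. C_on k S (\<lambda>x. D x i)" by auto
  have inv: "C_on k S (\<lambda>x. inverse (f x))" using Suc C_on_SucD by blast
  have "C_on k S (\<lambda>x. (- 1) * (inverse (f x) * D x i * inverse (f x)))" if "i \<in> Basis" for i
    using D(2) that by (intro C_on_mult C_on_const inv) auto
  then show ?case using D Suc.prems(2)
    by (auto intro!: exI[of _ "\<lambda>x i. - (inverse (f x) * D x i * inverse (f x))"] has_derivative_inverse)
qed

lemma C_on_imp_continuous_on: "C_on k S f \<Longrightarrow> continuous_on S f"
  by (induction k) (use C_on_SucD in \<open>auto simp del: C_on.simps(2)\<close>)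

lemma C_on_real_derivative:
  fixes f :: "real \<Rightarrow> real"
  assumes "C_on 1 UNIV f"
  shows "(f has_real_derivative deriv f x) (at x)" and "continuous_on UNIV (deriv f)"
proof -
  obtain D where D: "\<And>x. (f has_derivative D x) (at x)" "continuous_on UNIV (\<lambda>x. D x 1)"
    using assms by auto
  have "y * D x 1 = D x y" for x y
    by (metis D(1) has_derivative_linear linear_scale mult.right_neutral real_scaleR_def)
  with D(1) have d: "(f has_real_derivative D x 1) (at x)" for x
    by (rule has_derivative_imp_has_field_derivative)
  have "deriv f = (\<lambda>x. D x 1)" using d DERIV_imp_deriv by blast
  with d D(2) show "(f has_real_derivative deriv f x) (at x)" "continuous_on UNIV (deriv f)" by auto
qed

text \<open>The slices through a point stay in \<open>I \<times> J\<close>, so the total derivative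
  restricts to them and the chain rule yields partial derivatives. They are one-sided at boundary
  points, as the later integrations over closed rectangles require.\<close>

lemma C_on_partials:
  fixes f :: "real \<times> real \<Rightarrow> real"
  assumes "C_on (Suc k) (I \<times> J) f"
  obtains fx ft where "C_on k (I \<times> J) fx" "C_on k (I \<times> J) ft"
    "\<And>x t. x \<in> I \<Longrightarrow> t \<in> J \<Longrightarrow> ((\<lambda>x. f (x, t)) has_real_derivative fx (x, t)) (at x within I)"
    "\<And>x t. x \<in> I \<Longrightarrow> t \<in> J \<Longrightarrow> ((\<lambda>t. f (x, t)) has_real_derivative ft (x, t)) (at t within J)"
proof -
  obtain D where D: "\<And>p. p \<in> I \<times> J \<Longrightarrow> (f has_derivative D p) (at p within I \<times> J)"
      "\<And>i. i \<in> Basis \<Longrightarrow> C_on k (I \<times> J) (\<lambda>p. D p i)" using assms by auto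
  have C: "C_on k (I \<times> J) (\<lambda>p. D p (1, 0))" "C_on k (I \<times> J) (\<lambda>p. D p (0, 1))"
    by (rule D(2), simp add: Basis_prod_def)+
  have x: "((\<lambda>x. f (x, t)) has_real_derivative D (x, t) (1, 0)) (at x within I)"
    if "x \<in> I" "t \<in> J" for x t
  proof -
    have lin: "linear (D (x, t))"
      using D(1)[of "(x,t)"] that has_derivative_linear by auto
    have "(f has_derivative D (x, t)) (at (x, t) within (\<lambda>x. (x, t)) ` I)"
      using D(1)[of "(x,t)"] that by (auto intro: has_derivative_subset)
    from has_derivative_in_compose[OF has_derivative_Pair[OF has_derivative_ident has_derivative_const] this]
    have "((\<lambda>x. f (x, t)) has_derivative (\<lambda>h. D (x, t) (h, 0))) (at x within I)" .
    moreover have "(\<lambda>h. D (x, t) (h, 0)) = (*) (D (x, t) (1, 0))"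
    proof
      fix h
      have "(h, 0) = h *\<^sub>R ((1, 0) :: real \<times> real)" by simp
      then show "D (x, t) (h, 0) = D (x, t) (1, 0) * h"
        by (simp only: linear_scale[OF lin] real_scaleR_def mult.commute)
    qed
    ultimately show ?thesis by (simp add: has_field_derivative_def)
  qed
  have t: "((\<lambda>t. f (x, t)) has_real_derivative D (x, t) (0, 1)) (at t within J)"
    if "x \<in> I" "t \<in> J" for x t
  proof -
    have lin: "linear (D (x, t))"
      using D(1)[of "(x,t)"] that has_derivative_linear by auto
    have "(f has_derivative D (x, t)) (at (x, t) within (\<lambda>t. (x, t)) ` J)"
      using D(1)[of "(x,t)"] that by (auto intro: has_derivative_subset)
    from has_derivative_in_compose[OF has_derivative_Pair[OF has_derivative_const has_derivative_ident] this]
    have "((\<lambda>t. f (x, t)) has_derivative (\<lambda>h. D (x, t) (0, h))) (at t within J)" .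
    moreover have "(\<lambda>h. D (x, t) (0, h)) = (*) (D (x, t) (0, 1))"
    proof
      fix h
      have "(0, h) = h *\<^sub>R ((0, 1) :: real \<times> real)" by simp
      then show "D (x, t) (0, h) = D (x, t) (0, 1) * h"
        by (simp only: linear_scale[OF lin] real_scaleR_def mult.commute)
    qed
    ultimately show ?thesis by (simp add: has_field_derivative_def)
  qed
  show ?thesis using that[OF C x t] by blast
qed

subsection \<open>Integration over the space-time rectangle\<close>

lemma Q_eq_box: "Q L \<tau> = box (0, 0) (L, \<tau>)"
  by (auto simp: Q_def box_def Basis_prod_def)

lemma rect_eq_cbox: "{0..L} \<times> {0..\<tau>} = cbox (0, 0) (L, \<tau> :: real)" for L :: real
  by (auto simp: cbox_def Basis_prod_def)

lemma Q_subset_rect: "Q L \<tau> \<subseteq> {0..L} \<times> {0..\<tau>}"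
  by (auto simp: Q_def)

lemma Q_lebesgue [measurable]: "Q L \<tau> \<in> sets lebesgue"
  by (simp add: Q_eq_box)

text \<open>Bridge between the Lebesgue integrals over open boxes in the definitions and the gauge
  integrals over closed boxes, for which Fubini and the fundamental theorem are applied. The
  boundary of a box is null.\<close>

lemma integrable_on_box_continuous:
  fixes f :: "'a::euclidean_space \<Rightarrow> real"
  assumes "continuous_on (cbox a b) f"
  shows "integrable (lebesgue_on (box a b)) f"
    and "(LINT p|lebesgue_on (box a b). f p) = integral (cbox a b) f"
proof -
  have "f absolutely_integrable_on cbox a b"
    using absolutely_integrable_continuous[OF assms] .
  then have "f absolutely_integrable_on box a b"
    by (rule set_integrable_subset) (auto simp: box_subset_cbox)
  then show 1: "integrable (lebesgue_on (box a b)) f"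
    by (simp add: integrable_restrict_space set_integrable_def)
  show "(LINT p|lebesgue_on (box a b). f p) = integral (cbox a b) f"
    using lebesgue_integral_eq_integral[OF 1] by (simp add: integral_open_interval)
qed

lemma integrable_Q_continuous:
  fixes f :: "real \<times> real \<Rightarrow> real"
  assumes "continuous_on ({0..L} \<times> {0..\<tau>}) f"
  shows "integrable (lebesgue_on (Q L \<tau>)) f"
  using integrable_on_box_continuous(1) assms by (simp add: Q_eq_box rect_eq_cbox)

text \<open>Fubini for continuous functions, followed by the fundamental theorem on each vertical
  segment.\<close>

lemma integral_dt:
  fixes F :: "real \<times> real \<Rightarrow> real"
  assumes "0 < \<tau>" and "continuous_on ({0..L} \<times> {0..\<tau>}) F"
    and "continuous_on ({0..L} \<times> {0..\<tau>}) Ft"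
    and "\<And>x t. x \<in> {0..L} \<Longrightarrow> t \<in> {0..\<tau>} \<Longrightarrow>
          ((\<lambda>t. F (x, t)) has_real_derivative Ft (x, t)) (at t within {0..\<tau>})"
  shows "(LINT p|lebesgue_on (Q L \<tau>). Ft p) =
    (LINT x|lebesgue_on {0<..<L}. F (x, \<tau>) - F (x, 0))"
proof -
  have "(LINT p|lebesgue_on (Q L \<tau>). Ft p) = integral (cbox (0, 0) (L, \<tau>)) Ft"
    using integrable_on_box_continuous(2) assms(3) by (simp add: Q_eq_box rect_eq_cbox)
  also have "\<dots> = integral {0..L} (\<lambda>x. integral {0..\<tau>} (\<lambda>t. Ft (x, t)))"
    using integral_prod_continuous[of 0 0 L \<tau> Ft] assms(3) by (simp add: rect_eq_cbox)
  also have "\<dots> = integral {0..L} (\<lambda>x. F (x, \<tau>) - F (x, 0))"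
  proof (rule integral_cong)
    fix x assume "x \<in> {0..L}"
    then have "((\<lambda>t. Ft (x, t)) has_integral (F (x, \<tau>) - F (x, 0))) {0..\<tau>}"
      using assms by (intro fundamental_theorem_of_calculus)
        (auto simp: has_real_derivative_iff_has_vector_derivative[symmetric])
    then show "integral {0..\<tau>} (\<lambda>t. Ft (x, t)) = F (x, \<tau>) - F (x, 0)"
      by (rule integral_unique)
  qed
  also have "\<dots> = (LINT x|lebesgue_on {0<..<L}. F (x, \<tau>) - F (x, 0))"
  proof -
    have "continuous_on {0..L} (\<lambda>x. F (x, \<tau>) - F (x, 0))"
      using assms(1) by (intro continuous_on_diff continuous_on_compose2[OF assms(2)] continuous_intros) auto
    then show ?thesis
      using integrable_on_box_continuous(2)[of 0 L "\<lambda>x. F (x, \<tau>) - F (x, 0)"] by simp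
  qed
  finally show ?thesis .
qed

lemma integral_dx_eq_0:
  fixes H :: "real \<times> real \<Rightarrow> real"
  assumes "0 < L" and "continuous_on ({0..L} \<times> {0..\<tau>}) Hx"
    and "\<And>x t. x \<in> {0..L} \<Longrightarrow> t \<in> {0..\<tau>} \<Longrightarrow>
          ((\<lambda>x. H (x, t)) has_real_derivative Hx (x, t)) (at x within {0..L})"
    and "\<And>t. t \<in> {0<..<\<tau>} \<Longrightarrow> H (0, t) = 0 \<and> H (L, t) = 0"
  shows "(LINT p|lebesgue_on (Q L \<tau>). Hx p) = 0"
proof -
  have "(LINT p|lebesgue_on (Q L \<tau>). Hx p) = integral (cbox (0, 0) (L, \<tau>)) Hx"
    using integrable_on_box_continuous(2) assms(2) by (simp add: Q_eq_box rect_eq_cbox)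
  also have "\<dots> = integral {0..L} (\<lambda>x. integral {0..\<tau>} (\<lambda>t. Hx (x, t)))"
    using integral_prod_continuous[of 0 0 L \<tau> Hx] assms(2) by (simp add: rect_eq_cbox)
  also have "\<dots> = integral {0..\<tau>} (\<lambda>t. integral {0..L} (\<lambda>x. Hx (x, t)))"
    using integral_swap_continuous[of 0 0 L \<tau> "\<lambda>x t. Hx (x, t)"] assms(2) by (simp add: rect_eq_cbox)
  \<comment> \<open>The lateral condition on \<open>H\<close> is only assumed for interior times;
    dropping the two end times leaves the integral unchanged.\<close>
  also have "\<dots> = integral {0<..<\<tau>} (\<lambda>t. integral {0..L} (\<lambda>x. Hx (x, t)))"
    using integral_open_interval[of 0 \<tau> "\<lambda>t. integral {0..L} (\<lambda>x. Hx (x, t))"] by simp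
  also have "\<dots> = integral {0<..<\<tau>} (\<lambda>t. 0)"
  proof (rule integral_cong)
    fix t assume t: "t \<in> {0<..<\<tau>}"
    then have "((\<lambda>x. Hx (x, t)) has_integral (H (L, t) - H (0, t))) {0..L}"
      using assms(1,3) by (intro fundamental_theorem_of_calculus)
        (auto simp: has_real_derivative_iff_has_vector_derivative[symmetric])
    then show "integral {0..L} (\<lambda>x. Hx (x, t)) = 0"
      using assms(4)[OF t] integral_unique by force
  qed
  finally show ?thesis by simp
qed

section \<open>Lebesgue and Sobolev membership of classical functions\<close>

lemma L_infinity_continuous:
  assumes "continuous_on ({0..L} \<times> {0..\<tau>}) f"
  shows "L_infinity (Q L \<tau>) f"
proof -
  have "compact (f ` ({0..L} \<times> {0..\<tau>}))"
    using assms by (intro compact_continuous_image) (auto simp: compact_Times)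
  then obtain C where "\<forall>y\<in>f ` ({0..L} \<times> {0..\<tau>}). norm y \<le> C"
    using compact_imp_bounded bounded_iff by metis
  then have "\<bar>f p\<bar> \<le> C" if "p \<in> Q L \<tau>" for p
    using that Q_subset_rect[of L \<tau>] by auto
  then have "AE p in lebesgue_on (Q L \<tau>). \<bar>f p\<bar> \<le> C"
    by (intro AE_I2) (simp add: space_restrict_space)
  then show ?thesis unfolding L_infinity_def
    using borel_measurable_integrable[OF integrable_Q_continuous[OF assms]] by blast
qed

lemma L2_box_continuous:
  fixes f :: "'a::euclidean_space \<Rightarrow> real"
  assumes "continuous_on (cbox a b) f"
  shows "L2 (box a b) f"
  unfolding L2_def
  using integrable_on_box_continuous(1)[OF assms]
    integrable_on_box_continuous(1)[OF continuous_on_power[OF assms]] by blast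

lemma test_function_zero: "test_function S \<psi> \<Longrightarrow> x \<notin> S \<Longrightarrow> \<psi> x = 0"
  unfolding test_function_def using closure_subset[of "{x. \<psi> x \<noteq> 0}"] by blast

text \<open>Integration by parts: the product \<open>f x * \<zeta> x\<close> has vanishing boundary
  terms, because a test function on the open interval is zero at 0 and at \<open>L\<close>.\<close>

lemma H1_with_deriv_classical:
  assumes "0 < L" and "continuous_on {0..L} h"
    and "\<And>x. x \<in> {0..L} \<Longrightarrow> (f has_real_derivative h x) (at x within {0..L})"
  shows "H1_with_deriv L f h"
proof -
  have f: "continuous_on {0..L} f" using assms(3) DERIV_continuous_on by blast
  have "(LINT x|lebesgue_on {0<..<L}. f x * deriv \<zeta> x) =
        - (LINT x|lebesgue_on {0<..<L}. h x * \<zeta> x)" if \<zeta>: "test_function {0<..<L} \<zeta>" for \<zeta>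
  proof -
    have "C_on 1 UNIV \<zeta>" using \<zeta> unfolding test_function_def by blast
    note d = C_on_real_derivative[OF this]
    have c\<zeta>: "continuous_on {0..L} \<zeta>" "continuous_on {0..L} (\<lambda>x. deriv \<zeta> x)"
      using continuous_on_subset[OF d(2)] DERIV_continuous_on[OF DERIV_subset[OF d(1)]] by auto
    have i: "continuous_on (cbox 0 L) (\<lambda>x. f x * deriv \<zeta> x)" "continuous_on (cbox 0 L) (\<lambda>x. h x * \<zeta> x)"
      using c\<zeta> f assms(2) by (auto intro: continuous_intros)
    have "((\<lambda>x. f x * deriv \<zeta> x + h x * \<zeta> x) has_integral (f L * \<zeta> L - f 0 * \<zeta> 0)) {0..L}"
    proof (rule fundamental_theorem_of_calculus)
      fix x assume x: "x \<in> {0..L}"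
      have "((\<lambda>x. f x * \<zeta> x) has_real_derivative f x * deriv \<zeta> x + h x * \<zeta> x) (at x within {0..L})"
        using assms(3)[OF x] DERIV_subset[OF d(1)[of x], of "{0..L}"]
        by (auto intro!: derivative_eq_intros)
      then show "((\<lambda>x. f x * \<zeta> x) has_vector_derivative f x * deriv \<zeta> x + h x * \<zeta> x) (at x within {0..L})"
        by (simp add: has_real_derivative_iff_has_vector_derivative)
    qed (use assms in auto)
    then have "integral {0..L} (\<lambda>x. f x * deriv \<zeta> x + h x * \<zeta> x) = 0"
      using test_function_zero[OF \<zeta>] by (simp add: integral_unique)
    moreover have "integral {0..L} (\<lambda>x. f x * deriv \<zeta> x + h x * \<zeta> x) =
        integral {0..L} (\<lambda>x. f x * deriv \<zeta> x) + integral {0..L} (\<lambda>x. h x * \<zeta> x)"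
      using i by (intro integral_add) (auto intro: integrable_continuous_real)
    ultimately show ?thesis using integrable_on_box_continuous(2)[OF i(1)]
      integrable_on_box_continuous(2)[OF i(2)] by simp
  qed
  then show ?thesis using L2_box_continuous[of 0 L f] L2_box_continuous[of 0 L h] f assms(2)
    by (simp add: H1_with_deriv_def)
qed

lemma L2_H1_with_deriv_classical:
  assumes "0 < L" and "continuous_on ({0..L} \<times> {0..\<tau>}) v" "continuous_on ({0..L} \<times> {0..\<tau>}) vx"
    and "\<And>x t. x \<in> {0..L} \<Longrightarrow> t \<in> {0..\<tau>} \<Longrightarrow>
          ((\<lambda>x. v (x, t)) has_real_derivative vx (x, t)) (at x within {0..L})"
  shows "L2_H1_with_deriv L \<tau> v vx"
proof -
  have "H1_with_deriv L (\<lambda>x. v (x, t)) (\<lambda>x. vx (x, t))" if "t \<in> {0..\<tau>}" for t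
    using that assms
    by (intro H1_with_deriv_classical continuous_on_compose2[OF assms(3)] continuous_intros) auto
  then have "AE t in lebesgue_on {0<..<\<tau>}. H1_with_deriv L (\<lambda>x. v (x, t)) (\<lambda>x. vx (x, t))"
    by (intro AE_I2) (auto simp: space_restrict_space)
  then show ?thesis using assms(2,3) unfolding L2_H1_with_deriv_def Q_eq_box rect_eq_cbox
    by (auto intro!: L2_box_continuous)
qed

text \<open>\<open>dx\<close> and \<open>dt\<close> are two-sided derivatives, while the data on the
  closed rectangle are one-sided; at interior points the two notions agree.\<close>

lemma dx_eq:
  assumes "p \<in> Q L \<tau>"
    and "((\<lambda>x. f (x, snd p)) has_real_derivative d) (at (fst p) within {0..L})"
  shows "dx f p = d"
  using assms unfolding dx_def Q_def by (auto simp: at_within_Icc_at intro: DERIV_imp_deriv)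

lemma dt_eq:
  assumes "p \<in> Q L \<tau>"
    and "((\<lambda>t. f (fst p, t)) has_real_derivative d) (at (snd p) within {0..\<tau>})"
  shows "dt f p = d"
  using assms unfolding dt_def Q_def by (auto simp: at_within_Icc_at intro: DERIV_imp_deriv)

lemma dx_dx_eq:
  assumes p: "p \<in> Q L \<tau>"
    and f: "\<And>x t. x \<in> {0..L} \<Longrightarrow> t \<in> {0..\<tau>} \<Longrightarrow>
          ((\<lambda>x. f (x, t)) has_real_derivative fx (x, t)) (at x within {0..L})"
    and fx: "\<And>x t. x \<in> {0..L} \<Longrightarrow> t \<in> {0..\<tau>} \<Longrightarrow>
          ((\<lambda>x. fx (x, t)) has_real_derivative fxx (x, t)) (at x within {0..L})"
  shows "dx (dx f) p = fxx p"
proof -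
  obtain x t where xt: "p = (x, t)" "x \<in> {0<..<L}" "t \<in> {0<..<\<tau>}" using p by (auto simp: Q_def)
  have "((\<lambda>x. fx (x, t)) has_real_derivative fxx (x, t)) (at x)"
    using fx[of x t] xt by (simp add: at_within_Icc_at)
  \<comment> \<open>The identity of \<open>dx f\<close> with \<open>fx\<close> is available only for
    interior \<open>x\<close>, so the outer derivative is transferred on the open interval.\<close>
  then have "((\<lambda>x. dx f (x, t)) has_real_derivative fxx (x, t)) (at x)"
  proof (rule has_field_derivative_transform_within_open[OF _ open_greaterThanLessThan[of 0 L]])
    fix y assume "y \<in> {0<..<L}"
    then show "fx (y, t) = dx f (y, t)"
      using f[of y t] xt by (intro dx_eq[symmetric, of _ L \<tau>]) (auto simp: Q_def)
  qed (use xt in auto)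
  then show ?thesis unfolding dx_def xt(1) by (auto intro: DERIV_imp_deriv)
qed

text \<open>Common core of the weak formulation and of the entropy inequality: \<open>F\<close> is
  the density, \<open>H\<close> a flux vanishing on the lateral sides, and \<open>P\<close> the
  production that is left over.\<close>

lemma integral_divergence:
  fixes F H :: "real \<times> real \<Rightarrow> real"
  assumes "0 < L" "0 < \<tau>"
    and F: "continuous_on ({0..L} \<times> {0..\<tau>}) F" "continuous_on ({0..L} \<times> {0..\<tau>}) Ft"
      "\<And>x t. x \<in> {0..L} \<Longrightarrow> t \<in> {0..\<tau>} \<Longrightarrow>
          ((\<lambda>t. F (x, t)) has_real_derivative Ft (x, t)) (at t within {0..\<tau>})"
    and H: "continuous_on ({0..L} \<times> {0..\<tau>}) Hx"
      "\<And>x t. x \<in> {0..L} \<Longrightarrow> t \<in> {0..\<tau>} \<Longrightarrow>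
          ((\<lambda>x. H (x, t)) has_real_derivative Hx (x, t)) (at x within {0..L})"
      "\<And>t. t \<in> {0<..<\<tau>} \<Longrightarrow> H (0, t) = 0 \<and> H (L, t) = 0"
    and P: "continuous_on ({0..L} \<times> {0..\<tau>}) P"
    and f: "\<And>p. p \<in> Q L \<tau> \<Longrightarrow> f p = Ft p - Hx p + P p"
  shows "(LINT p|lebesgue_on (Q L \<tau>). f p) =
    (LINT x|lebesgue_on {0<..<L}. F (x, \<tau>) - F (x, 0)) + (LINT p|lebesgue_on (Q L \<tau>). P p)"
proof -
  have "(LINT p|lebesgue_on (Q L \<tau>). f p) = (LINT p|lebesgue_on (Q L \<tau>). Ft p - Hx p + P p)"
    using f by (intro Bochner_Integration.integral_cong) (auto simp: space_restrict_space)
  also have "\<dots> = (LINT p|lebesgue_on (Q L \<tau>). Ft p) - (LINT p|lebesgue_on (Q L \<tau>). Hx p)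
      + (LINT p|lebesgue_on (Q L \<tau>). P p)"
    using integrable_Q_continuous[OF F(2)] integrable_Q_continuous[OF H(1)]
      integrable_Q_continuous[OF P] by simp
  also have "(LINT p|lebesgue_on (Q L \<tau>). Hx p) = 0"
    using integral_dx_eq_0[OF assms(1) H] .
  also have "(LINT p|lebesgue_on (Q L \<tau>). Ft p) = (LINT x|lebesgue_on {0<..<L}. F (x, \<tau>) - F (x, 0))"
    using integral_dt[OF assms(2) F] .
  finally show ?thesis by simp
qed

subsection \<open>The piecewise linear nonlinearity\<close>

definition kappa :: "nonlinearity \<Rightarrow> real" where
  "kappa N = (turn_c N - turn_b N) / (level_B N - level_A N)"

text \<open>The slope of \<open>\<beta>\<^sub>2 - \<beta>\<^sub>0\<close>, which vanishes at \<open>A\<close>.\<close>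
definition rate :: "nonlinearity \<Rightarrow> real" where
  "rate N = 1 / slope2 N + kappa N"

lemma kappa_pos: "admissible N \<Longrightarrow> 0 < kappa N"
  by (simp add: admissible_def kappa_def)

lemma rate_gt_kappa: "admissible N \<Longrightarrow> kappa N < rate N"
  by (simp add: admissible_def rate_def)

text \<open>Both the middle and the right branch are written from their common point
  \<open>(turn_c N, level_A N)\<close>. Thus \<open>w - level_A N\<close> becomes the single
  variable in which \<open>beta0\<close> and \<open>beta2\<close> are affine.\<close>

lemma phi0_eq: "admissible N \<Longrightarrow> phi0 N s = level_A N + (turn_c N - s) / kappa N"
  unfolding admissible_def phi0_def kappa_def by (simp add: divide_simps) (simp add: algebra_simps)

lemma phi2_eq: "phi2 N s = level_A N + slope2 N * (s - turn_c N)"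
  by (simp add: phi2_def level_A_def algebra_simps)

lemma level_B_eq: "admissible N \<Longrightarrow> level_B N = level_A N + (turn_c N - turn_b N) / kappa N"
  by (simp add: admissible_def kappa_def)

text \<open>The formula reaches the closed interval because the outer branches, which define
  \<open>phi\<close> at the two end points, take the values B and A there.\<close>

lemma phi_middle:
  assumes "admissible N" and "s \<in> {turn_b N..turn_c N}"
  shows "phi N s = level_A N + (turn_c N - s) / kappa N"
proof -
  consider "s = turn_b N" | "turn_b N < s" "s < turn_c N" | "s = turn_c N" using assms(2) by force
  then show ?thesis
  proof cases
    case 1
    then show ?thesis using level_B_eq[OF assms(1)] by (simp add: phi_def level_B_def)
  next
    case 2
    then show ?thesis using phi0_eq[OF assms(1)] by (simp add: phi_def)
  next
    case 3
    then show ?thesis using assms(1) by (simp add: phi_def level_A_def admissible_def)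
  qed
qed

lemma phi_right:
  assumes "admissible N" and "turn_c N \<le> s"
  shows "phi N s = level_A N + slope2 N * (s - turn_c N)"
  using assms by (simp add: phi_def phi2_eq admissible_def)

lemma continuous_phi:
  assumes "admissible N"
  shows "continuous_on UNIV (phi N)"
proof -
  have "continuous_on ({..turn_b N} \<union> ({turn_b N..turn_c N} \<union> {turn_c N..})) (phi N)"
  proof (intro continuous_on_closed_Un closed_Un)
    show "continuous_on {..turn_b N} (phi N)"
    proof (rule continuous_on_cong[THEN iffD1])
      show "continuous_on {..turn_b N} (\<lambda>s. slope1 N * s + offset1 N)" by (intro continuous_intros)
    qed (auto simp: phi_def phi1_def)
    show "continuous_on {turn_b N..turn_c N} (phi N)"
    proof (rule continuous_on_cong[THEN iffD1])
      show "continuous_on {turn_b N..turn_c N} (\<lambda>s. level_A N + (turn_c N - s) / kappa N)"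
        using kappa_pos[OF assms] by (intro continuous_intros) auto
    qed (use phi_middle[OF assms] in auto)
    show "continuous_on {turn_c N..} (phi N)"
    proof (rule continuous_on_cong[THEN iffD1])
      show "continuous_on {turn_c N..} (\<lambda>s. level_A N + slope2 N * (s - turn_c N))"
        by (intro continuous_intros)
    qed (use phi_right[OF assms] in auto)
  qed auto
  moreover have "{..turn_b N} \<union> ({turn_b N..turn_c N} \<union> {turn_c N..}) = UNIV" by auto
  ultimately show ?thesis by simp
qed

lemma beta0_eq:
  assumes "admissible N" and "w \<in> {level_A N..level_B N}"
  shows "beta0 N w = turn_c N - kappa N * (w - level_A N)"
  unfolding beta0_def
proof (rule the_inv_into_f_eq)
  note k = kappa_pos[OF assms(1)]
  show "inj_on (phi0 N) {turn_b N..turn_c N}"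
    using k by (auto simp: inj_on_def phi0_eq[OF assms(1)])
  show "phi0 N (turn_c N - kappa N * (w - level_A N)) = w"
    using k by (simp add: phi0_eq[OF assms(1)])
  have "kappa N * (w - level_A N) \<le> kappa N * (level_B N - level_A N)"
    using assms(2) k by (intro mult_left_mono) auto
  also have "\<dots> = turn_c N - turn_b N" using assms(1) by (simp add: kappa_def admissible_def)
  finally show "turn_c N - kappa N * (w - level_A N) \<in> {turn_b N..turn_c N}" using assms(2) k by auto
qed

lemma beta2_eq:
  assumes "admissible N" and "level_A N \<le> w"
  shows "beta2 N w = turn_c N + (w - level_A N) / slope2 N"
  unfolding beta2_def
proof (rule the_inv_into_f_eq)
  have k: "0 < slope2 N" using assms(1) by (simp add: admissible_def)
  show "inj_on (phi2 N) {turn_c N..}"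
    using k by (auto simp: inj_on_def phi2_eq)
  show "phi2 N (turn_c N + (w - level_A N) / slope2 N) = w" using k by (simp add: phi2_eq)
  show "turn_c N + (w - level_A N) / slope2 N \<in> {turn_c N..}" using k assms by simp
qed

section \<open>The entropy primitive along the two branches\<close>

lemma entropy_G_derivative:
  assumes "admissible N" and "continuous_on UNIV g"
  shows "(entropy_G N g K has_real_derivative g (phi N s)) (at s)"
proof -
  \<comment> \<open>The margin 1 on either side makes \<open>s\<close> an interior point, so that
    the derivative within \<open>{a..b}\<close> is two-sided.\<close>
  define a b where "a = min 0 s - 1" and "b = max 0 s + 1"
  have c: "continuous_on {a..b} (\<lambda>s. g (phi N s))"
    using continuous_on_compose2[OF assms(2) continuous_phi[OF assms(1)]]
    by (auto intro: continuous_on_subset)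
  have "((\<lambda>u. LBINT s=ereal 0..ereal u. g (phi N s)) has_vector_derivative g (phi N s)) (at s within {a..b})"
    using interval_integral_FTC2[of a 0 b "\<lambda>s. g (phi N s)" s] c by (auto simp: a_def b_def zero_ereal_def)
  then have "((\<lambda>u. LBINT s=ereal 0..ereal u. g (phi N s)) has_real_derivative g (phi N s)) (at s)"
    by (simp add: has_real_derivative_iff_has_vector_derivative a_def b_def at_within_Icc_at)
  then show ?thesis unfolding entropy_G_def[abs_def] by (auto intro!: derivative_eq_intros)
qed

text \<open>The interval from \<open>beta0 N w\<close> to \<open>beta2 N w\<close> has length
  \<open>rate N * (w - level_A N)\<close>. On it \<open>phi N\<close> falls from \<open>w\<close> to
  A and climbs back to \<open>w\<close>, hence never exceeds \<open>w\<close>; the mean value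
  theorem and monotonicity of \<open>g\<close> give the bound.\<close>

lemma entropy_G_increment_le:
  assumes "admissible N" and g: "continuous_on UNIV g" "mono g"
    and w: "w \<in> {level_A N<..level_B N}"
  shows "entropy_G N g K (turn_c N + (w - level_A N) / slope2 N)
      - entropy_G N g K (turn_c N - kappa N * (w - level_A N)) \<le> g w * (rate N * (w - level_A N))"
proof -
  define d where "d = w - level_A N"
  have k: "0 < kappa N" "0 < slope2 N" "0 < d"
    using assms kappa_pos by (auto simp: admissible_def d_def)
  let ?l = "turn_c N - kappa N * d" and ?r = "turn_c N + d / slope2 N"
  have lr: "?l < ?r" using k by (smt (verit) divide_pos_pos mult_pos_pos)
  obtain z where z: "?l < z" "z < ?r"
      "entropy_G N g K ?r - entropy_G N g K ?l = (?r - ?l) * g (phi N z)"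
    using MVT2[OF lr, of "entropy_G N g K" "\<lambda>s. g (phi N s)"] entropy_G_derivative[OF assms(1) g(1)] by blast
  \<comment> \<open>Because \<open>w\<close> is at most B, the left end does not pass
    \<open>turn_b N\<close>, and only the middle and right branches are met.\<close>
  have b: "turn_b N \<le> ?l"
  proof -
    have "kappa N * d \<le> kappa N * (level_B N - level_A N)"
      using w k by (intro mult_left_mono) (auto simp: d_def)
    also have "\<dots> = turn_c N - turn_b N" using assms(1) by (simp add: kappa_def admissible_def)
    finally show ?thesis by simp
  qed
  have "phi N z \<le> w"
  proof (cases "z \<le> turn_c N")
    case True
    then have "phi N z = level_A N + (turn_c N - z) / kappa N"
      using z b phi_middle[OF assms(1)] by auto
    moreover have "(turn_c N - z) / kappa N \<le> d" using z(1) k by (simp add: field_simps)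
    ultimately show ?thesis by (simp add: d_def)
  next
    case False
    then have "phi N z = level_A N + slope2 N * (z - turn_c N)"
      using phi_right[OF assms(1)] by auto
    moreover have "slope2 N * (z - turn_c N) \<le> d" using z(2) k by (simp add: field_simps)
    ultimately show ?thesis by (simp add: d_def)
  qed
  then have "g (phi N z) \<le> g w" using g(2) by (auto dest: monoD)
  then have "(?r - ?l) * g (phi N z) \<le> (?r - ?l) * g w" using lr by (intro mult_left_mono) auto
  then show ?thesis using z(3) unfolding d_def[symmetric] by (simp add: rate_def algebra_simps)
qed

subsection \<open>Solutions with a raised flux\<close>

definition raised_flux :: "nonlinearity \<Rightarrow> (real \<times> real \<Rightarrow> real) \<Rightarrow> real \<Rightarrow> real \<times> real \<Rightarrow> real" where
  "raised_flux N u \<epsilon> p = phi N (u p) + \<epsilon> * snd p"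

text \<open>The numerator is the amount by which \<open>beta0\<close> drops when the flux is raised,
  the denominator the gap \<open>beta2 - beta0\<close> at the raised flux.\<close>

definition stable_fraction :: "nonlinearity \<Rightarrow> (real \<times> real \<Rightarrow> real) \<Rightarrow> real \<Rightarrow> real \<times> real \<Rightarrow> real" where
  "stable_fraction N u \<epsilon> p =
     kappa N * \<epsilon> * snd p / (rate N * (raised_flux N u \<epsilon> p - level_A N))"

text \<open>A flow inside the unstable phase, with partial derivatives valid up to the boundary. In
  \<open>pde\<close> the slope \<open>-1 / kappa N\<close> of the middle branch is already inserted.
  The time is short in two ways: \<open>small_c\<close> makes the stable fraction nondecreasing, and
  \<open>small_b\<close> keeps the raised flux from exceeding B. Neither bound involves
  \<open>\<epsilon>\<close>.\<close>

locale unstable_flow =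
  fixes N :: nonlinearity and L \<tau> \<epsilon> :: real and u ux ut uxx :: "real \<times> real \<Rightarrow> real"
  assumes adm: "admissible N" and L: "0 < L" and \<tau>: "0 < \<tau>" and \<epsilon>: "0 \<le> \<epsilon>" "\<epsilon> \<le> 1"
    and C2: "C_on 2 ({0..L} \<times> {0..\<tau>}) u"
    and cont_partials: "continuous_on ({0..L} \<times> {0..\<tau>}) ux" "continuous_on ({0..L} \<times> {0..\<tau>}) ut"
      "continuous_on ({0..L} \<times> {0..\<tau>}) uxx"
    and ux: "\<And>x t. x \<in> {0..L} \<Longrightarrow> t \<in> {0..\<tau>} \<Longrightarrow>
      ((\<lambda>x. u (x, t)) has_real_derivative ux (x, t)) (at x within {0..L})"
    and ut: "\<And>x t. x \<in> {0..L} \<Longrightarrow> t \<in> {0..\<tau>} \<Longrightarrow>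
      ((\<lambda>t. u (x, t)) has_real_derivative ut (x, t)) (at t within {0..\<tau>})"
    and uxx: "\<And>x t. x \<in> {0..L} \<Longrightarrow> t \<in> {0..\<tau>} \<Longrightarrow>
      ((\<lambda>x. ux (x, t)) has_real_derivative uxx (x, t)) (at x within {0..L})"
    and neumann: "\<And>t. t \<in> {0<..<\<tau>} \<Longrightarrow> ux (0, t) = 0 \<and> ux (L, t) = 0"
    and pde: "\<And>p. p \<in> Q L \<tau> \<Longrightarrow> ut p = - uxx p / kappa N"
    and range_u: "\<And>p. p \<in> {0..L} \<times> {0..\<tau>} \<Longrightarrow> turn_b N < u p \<and> u p < turn_c N"
    and small_c: "\<And>p. p \<in> {0..L} \<times> {0..\<tau>} \<Longrightarrow> \<tau> * \<bar>ut p\<bar> \<le> turn_c N - u p"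
    and small_b: "\<And>p. p \<in> {0..L} \<times> {0..\<tau>} \<Longrightarrow> kappa N * \<tau> \<le> u p - turn_b N"
begin

section \<open>Raised flux and stable fraction: bounds and derivatives\<close>

abbreviation "R \<equiv> {0..L} \<times> {0..\<tau>}"
abbreviation "w \<equiv> raised_flux N u \<epsilon>"
abbreviation "l \<equiv> stable_fraction N u \<epsilon>"

definition "wx p = - ux p / kappa N"
definition "wxx p = - uxx p / kappa N"
definition "wt p = - ut p / kappa N + \<epsilon>"
definition "lt p = kappa N * \<epsilon> / rate N * ((w p - level_A N) - snd p * wt p) / (w p - level_A N)\<^sup>2"

lemma slope2: "0 < slope2 N"
  using adm by (simp add: admissible_def)

lemma kappa: "0 < kappa N"
  using kappa_pos adm .

lemma rate: "0 < rate N" "kappa N < rate N"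
  using kappa rate_gt_kappa[OF adm] by auto

lemma Q_R: "p \<in> Q L \<tau> \<Longrightarrow> p \<in> R"
  using Q_subset_rect by blast

lemma cont_u: "continuous_on R u"
  using C_on_imp_continuous_on[OF C2] .

lemma w_eq:
  assumes "p \<in> R"
  shows "w p = level_A N + (turn_c N - u p) / kappa N + \<epsilon> * snd p"
  using phi_middle[OF adm, of "u p"] range_u[OF assms] by (simp add: raised_flux_def)

text \<open>Strictness at A keeps the divisor in \<open>l\<close> nonzero on the whole closed
  rectangle. The bound by B, from \<open>\<epsilon> \<le> 1\<close> and \<open>small_b\<close>,
  keeps \<open>w\<close> in the domain of \<open>beta0\<close> and makes the condition for
  \<open>v > level_B N\<close> vacuous.\<close>

lemma w_range:
  assumes "p \<in> R"
  shows "level_A N < w p" "w p \<le> level_B N"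
proof -
  have t: "0 \<le> snd p" "snd p \<le> \<tau>" using assms by auto
  have "0 < (turn_c N - u p) / kappa N" using range_u[OF assms] kappa by simp
  moreover have "0 \<le> \<epsilon> * snd p" using \<epsilon> t by simp
  ultimately show "level_A N < w p" using w_eq[OF assms] by linarith
  have "\<epsilon> * snd p \<le> 1 * \<tau>" using \<epsilon> t by (intro mult_mono) auto
  also have "\<dots> \<le> (u p - turn_b N) / kappa N"
    using small_b[OF assms] kappa by (simp add: field_simps)
  finally have "(turn_c N - u p) / kappa N + \<epsilon> * snd p \<le> (turn_c N - turn_b N) / kappa N"
    using kappa by (simp add: diff_divide_distrib)
  then show "w p \<le> level_B N" using w_eq[OF assms] level_B_eq[OF adm] by simp
qed

lemma cont_w: "continuous_on R w"
proof (rule continuous_on_cong[THEN iffD1])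
  show "continuous_on R (\<lambda>p. level_A N + (turn_c N - u p) / kappa N + \<epsilon> * snd p)"
    using kappa by (intro continuous_intros cont_u) auto
qed (use w_eq in auto)

lemma cont_w_partials: "continuous_on R wx" "continuous_on R wxx" "continuous_on R wt"
  unfolding wx_def[abs_def] wxx_def[abs_def] wt_def[abs_def]
  using kappa by (intro continuous_intros cont_partials; simp)+

lemma wx:
  assumes "x \<in> {0..L}" "t \<in> {0..\<tau>}"
  shows "((\<lambda>x. w (x, t)) has_real_derivative wx (x, t)) (at x within {0..L})"
\<comment> \<open>By \<open>w_eq\<close> the flux is affine in \<open>u\<close> and \<open>t\<close>
  on the rectangle; this formula is differentiated in place of \<open>phi\<close>. The radius 1 is
  arbitrary, since the formula holds on the entire segment.\<close>
proof (rule has_field_derivative_transform_within[of _ _ _ _ 1])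
  show "((\<lambda>x. level_A N + (turn_c N - u (x, t)) / kappa N + \<epsilon> * t) has_real_derivative wx (x, t))
      (at x within {0..L})"
    using kappa unfolding wx_def by (auto intro!: derivative_eq_intros ux[OF assms])
qed (use assms w_eq in auto)

lemma wxx:
  assumes "x \<in> {0..L}" "t \<in> {0..\<tau>}"
  shows "((\<lambda>x. wx (x, t)) has_real_derivative wxx (x, t)) (at x within {0..L})"
  using kappa unfolding wx_def wxx_def by (auto intro!: derivative_eq_intros uxx[OF assms])

lemma wt:
  assumes "x \<in> {0..L}" "t \<in> {0..\<tau>}"
  shows "((\<lambda>t. w (x, t)) has_real_derivative wt (x, t)) (at t within {0..\<tau>})"
proof (rule has_field_derivative_transform_within[of _ _ _ _ 1])
  show "((\<lambda>t. level_A N + (turn_c N - u (x, t)) / kappa N + \<epsilon> * t) has_real_derivative wt (x, t))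
      (at t within {0..\<tau>})"
    using kappa unfolding wt_def by (auto intro!: derivative_eq_intros ut[OF assms])
qed (use assms w_eq in auto)

lemma l_eq: "l p = kappa N * \<epsilon> / rate N * (snd p / (w p - level_A N))"
  by (simp add: stable_fraction_def)

lemma cont_l: "continuous_on R l"
  unfolding l_eq[abs_def] using w_range(1) by (intro continuous_intros cont_w) force

lemma cont_lt: "continuous_on R lt"
  unfolding lt_def[abs_def] using w_range(1) rate
  by (intro continuous_intros cont_w cont_w_partials) force+

lemma lt:
  assumes "x \<in> {0..L}" "t \<in> {0..\<tau>}"
  shows "((\<lambda>t. l (x, t)) has_real_derivative lt (x, t)) (at t within {0..\<tau>})"
proof -
  have nz: "w (x, t) - level_A N \<noteq> 0" using w_range(1)[of "(x, t)"] assms by auto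
  have "((\<lambda>t. t / (w (x, t) - level_A N)) has_real_derivative
      (1 * (w (x, t) - level_A N) - t * (wt (x, t) - 0)) / ((w (x, t) - level_A N) * (w (x, t) - level_A N)))
      (at t within {0..\<tau>})"
    by (intro DERIV_divide DERIV_ident DERIV_diff DERIV_const wt assms nz)
  from DERIV_cmult[OF this, of "kappa N * \<epsilon> / rate N"]
  show ?thesis unfolding l_eq lt_def by (simp add: power2_eq_square)
qed

text \<open>The upper bound combines \<open>kappa N < rate N\<close> with the fact that
  \<open>w\<close> exceeds A by at least \<open>\<epsilon> * snd p\<close>.\<close>

lemma l_range:
  assumes "p \<in> R"
  shows "0 \<le> l p" "l p \<le> 1"
proof -
  define d where "d = w p - level_A N"
  have t: "0 \<le> snd p" using assms by auto
  have d: "0 < d" "\<epsilon> * snd p \<le> d"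
    using w_range(1)[OF assms] w_eq[OF assms] range_u[OF assms] kappa by (auto simp: d_def)
  show "0 \<le> l p" unfolding stable_fraction_def d_def[symmetric] using d kappa rate \<epsilon> t by simp
  have "kappa N * (\<epsilon> * snd p) \<le> rate N * d" using d rate kappa t \<epsilon> by (intro mult_mono) auto
  then show "l p \<le> 1" unfolding stable_fraction_def d_def[symmetric] using d rate
    by (simp add: mult.assoc)
qed

text \<open>In the numerator of the quotient rule the terms with \<open>\<epsilon>\<close> cancel,
  leaving \<open>(turn_c N - u p + snd p * ut p) / kappa N\<close>. The worst case is a decreasing
  \<open>u\<close>, which \<open>small_c\<close> absorbs.\<close>

lemma lt_nonneg:
  assumes "p \<in> R"
  shows "0 \<le> lt p"
proof -
  have t: "0 \<le> snd p" "snd p \<le> \<tau>" using assms by auto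
  have "- (snd p * ut p) = snd p * (- ut p)" by simp
  also have "\<dots> \<le> snd p * \<bar>ut p\<bar>" using t by (intro mult_left_mono) auto
  also have "\<dots> \<le> \<tau> * \<bar>ut p\<bar>" using t by (intro mult_right_mono) auto
  also have "\<dots> \<le> turn_c N - u p" using small_c[OF assms] .
  finally have "0 \<le> (turn_c N - u p + snd p * ut p) / kappa N" using kappa by simp
  also have "\<dots> = (w p - level_A N) - snd p * wt p"
    unfolding w_eq[OF assms] wt_def using kappa by (simp add: field_simps)
  finally show ?thesis unfolding lt_def using kappa rate \<epsilon> by simp
qed

lemma beta_w:
  assumes "p \<in> R"
  shows "beta0 N (w p) = turn_c N - kappa N * (w p - level_A N)"
    and "beta2 N (w p) = turn_c N + (w p - level_A N) / slope2 N"
  using beta0_eq[OF adm, of "w p"] beta2_eq[OF adm, of "w p"] w_range[OF assms] by auto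

lemma u_mixture:
  assumes "p \<in> R"
  shows "u p = (1 - l p) * beta0 N (w p) + l p * beta2 N (w p)"
proof -
  define d where "d = w p - level_A N"
  have d: "0 < d" using w_range(1)[OF assms] by (simp add: d_def)
  have "(1 - l p) * beta0 N (w p) + l p * beta2 N (w p) = turn_c N - kappa N * d + l p * (rate N * d)"
    unfolding beta_w[OF assms] d_def[symmetric] rate_def by (simp add: algebra_simps)
  \<comment> \<open>The mass moved to the stable branch exactly compensates the drop of
    \<open>beta0\<close> computed in the next equation.\<close>
  also have "l p * (rate N * d) = kappa N * \<epsilon> * snd p"
    unfolding stable_fraction_def d_def[symmetric] using d rate by simp
  also have "kappa N * d = turn_c N - u p + kappa N * \<epsilon> * snd p"
    unfolding d_def w_eq[OF assms] using kappa by (simp add: field_simps)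
  finally show ?thesis by simp
qed

lemma wxx_eq_ut: "p \<in> Q L \<tau> \<Longrightarrow> wxx p = ut p"
  using pde by (simp add: wxx_def)

lemma C2_w: "C_on 2 R w"
proof (rule C_on_cong)
  show "C_on 2 R (\<lambda>p. (level_A N + turn_c N / kappa N) + ((- 1 / kappa N) * u p + \<epsilon> * snd p))"
    by (intro C_on_add C_on_mult C_on_const C2 C_on_bounded_linear bounded_linear_snd)
qed (simp add: w_eq diff_divide_distrib)

lemma C1_l: "C_on 1 R l"
proof (rule C_on_cong)
  have w: "C_on 1 R w" using C_on_SucD[of 1 R w] C2_w by (simp only: Suc_1)
  have nz: "w p + (- level_A N) \<noteq> 0" if "p \<in> R" for p using w_range(1)[OF that] by simp
  show "C_on 1 R (\<lambda>p. (kappa N * \<epsilon> / rate N) * (snd p * inverse (w p + (- level_A N))))"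
    by (rule C_on_mult[OF C_on_const C_on_mult[OF C_on_bounded_linear[OF bounded_linear_snd]
          C_on_inverse[OF C_on_add[OF w C_on_const] nz]]])
next
  fix p assume "p \<in> R"
  show "(kappa N * \<epsilon> / rate N) * (snd p * inverse (w p + (- level_A N))) = l p"
    by (simp only: l_eq divide_inverse diff_conv_add_uminus)
qed

section \<open>Verification of the two notions of solution\<close>

lemma two_phase: "two_phase_regular_solution N L \<tau> (\<lambda>x. u (x, 0)) u l w"
  unfolding two_phase_regular_solution_def
proof (intro conjI ballI)
  have sub: "{0<..<L} \<times> {0..<\<tau>} \<subseteq> R" by auto
  show "continuous_on ({0<..<L} \<times> {0..<\<tau>}) u" "continuous_on ({0<..<L} \<times> {0..<\<tau>}) l"
    using continuous_on_subset[OF _ sub] cont_u cont_l by blast+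
  show "C_on 2 (Q L \<tau>) u" "C_on 1 (Q L \<tau>) l" "C_on 2 (Q L \<tau>) w"
    using C_on_subset[OF _ Q_subset_rect] C2 C1_l C2_w by blast+
  show "((\<lambda>x. dx w (x, t)) \<longlongrightarrow> 0) (at_right 0)" "((\<lambda>x. dx w (x, t)) \<longlongrightarrow> 0) (at_left L)"
    if t: "t \<in> {0<..<\<tau>}" for t
  proof -
    have c: "continuous_on {0..L} (\<lambda>x. wx (x, t))"
      using t by (intro continuous_on_compose2[OF cont_w_partials(1)] continuous_intros) auto
    have bc: "wx (0, t) = 0" "wx (L, t) = 0" using neumann[OF t] by (auto simp: wx_def)
    \<comment> \<open>\<open>wx\<close> is continuous up to the boundary and vanishes there; the
      limits of \<open>dx w\<close> follow because the two agree at interior points.\<close>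
    have eq: "wx (x, t) = dx w (x, t)" if "x \<in> {0<..<L}" for x
      using that t wx by (intro dx_eq[symmetric, of _ L \<tau>]) (auto simp: Q_def)
    have "((\<lambda>x. wx (x, t)) \<longlongrightarrow> 0) (at_right 0)"
      using continuous_on_Icc_at_rightD[OF c L] bc by simp
    then show "((\<lambda>x. dx w (x, t)) \<longlongrightarrow> 0) (at_right 0)"
      using eq eventually_at_right[OF L] by (elim Lim_transform_eventually) (auto intro: exI[of _ L] L)
    have "((\<lambda>x. wx (x, t)) \<longlongrightarrow> 0) (at_left L)"
      using continuous_on_Icc_at_leftD[OF c L] bc by simp
    then show "((\<lambda>x. dx w (x, t)) \<longlongrightarrow> 0) (at_left L)"
      using eq eventually_at_left[OF L] by (elim Lim_transform_eventually) (auto intro: exI[of _ 0] L)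
  qed
  fix p assume p: "p \<in> Q L \<tau>"
  note pR = Q_R[OF p]
  obtain x t where xt: "p = (x, t)" by (cases p)
  show "level_A N \<le> w p" "w p > level_B N \<longrightarrow> l p = 1" using w_range[OF pR] by auto
  show "u p = (1 - l p) * beta0 N (w p) + l p * beta2 N (w p)" using u_mixture[OF pR] .
  show "0 \<le> l p" "l p \<le> 1" using l_range[OF pR] by auto
  have "dt u p = ut p" using ut pR xt by (intro dt_eq[OF p]) auto
  also have "\<dots> = dx (dx w) p" using wxx_eq_ut[OF p] dx_dx_eq[OF p wx wxx] by simp
  finally show "dt u p = dx (dx w) p" .
  have "dt l p = lt p" using lt pR xt by (intro dt_eq[OF p]) auto
  then show "0 \<le> dt l p" using lt_nonneg[OF pR] by simp
qed simp

lemma weak_formulation: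
  assumes "C_on 1 R \<psi>" and "\<forall>x\<in>{0..L}. \<psi> (x, \<tau>) = 0"
  shows "(LINT p|lebesgue_on (Q L \<tau>). u p * dt \<psi> p - wx p * dx \<psi> p) +
    (LINT x|lebesgue_on {0<..<L}. u (x, 0) * \<psi> (x, 0)) = 0"
proof -
  obtain \<psi>x \<psi>t where c\<psi>': "C_on 0 R \<psi>x" "C_on 0 R \<psi>t"
    and \<psi>x: "\<And>x t. x \<in> {0..L} \<Longrightarrow> t \<in> {0..\<tau>} \<Longrightarrow>
      ((\<lambda>x. \<psi> (x, t)) has_real_derivative \<psi>x (x, t)) (at x within {0..L})"
    and \<psi>t: "\<And>x t. x \<in> {0..L} \<Longrightarrow> t \<in> {0..\<tau>} \<Longrightarrow>
      ((\<lambda>t. \<psi> (x, t)) has_real_derivative \<psi>t (x, t)) (at t within {0..\<tau>})"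
    using C_on_partials[of 0 "{0..L}" "{0..\<tau>}" \<psi>] assms(1) unfolding One_nat_def by metis
  have c: "continuous_on R \<psi>" "continuous_on R \<psi>x" "continuous_on R \<psi>t"
    using c\<psi>' C_on_imp_continuous_on[OF assms(1)] by auto
  have "(LINT p|lebesgue_on (Q L \<tau>). u p * dt \<psi> p - wx p * dx \<psi> p) =
      (LINT x|lebesgue_on {0<..<L}. u (x, \<tau>) * \<psi> (x, \<tau>) - u (x, 0) * \<psi> (x, 0)) +
      (LINT p|lebesgue_on (Q L \<tau>). (wxx p - ut p) * \<psi> p)"
  \<comment> \<open>Here the lateral flux vanishes by the Neumann condition, as
    \<open>\<psi>\<close> is free on the sides. The production is zero by \<open>wxx_eq_ut\<close>,
    and at the final time \<open>\<psi>\<close> vanishes, which leaves the initial term.\<close>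
  proof (rule integral_divergence[where F = "\<lambda>p. u p * \<psi> p" and Ft = "\<lambda>p. ut p * \<psi> p + \<psi>t p * u p"
        and H = "\<lambda>p. wx p * \<psi> p" and Hx = "\<lambda>p. wxx p * \<psi> p + \<psi>x p * wx p"])
    show "((\<lambda>t. u (x, t) * \<psi> (x, t)) has_real_derivative
        ut (x, t) * \<psi> (x, t) + \<psi>t (x, t) * u (x, t)) (at t within {0..\<tau>})"
      if "x \<in> {0..L}" "t \<in> {0..\<tau>}" for x t by (intro DERIV_mult ut \<psi>t that)
    show "((\<lambda>x. wx (x, t) * \<psi> (x, t)) has_real_derivative
        wxx (x, t) * \<psi> (x, t) + \<psi>x (x, t) * wx (x, t)) (at x within {0..L})"
      if "x \<in> {0..L}" "t \<in> {0..\<tau>}" for x t by (intro DERIV_mult wxx \<psi>x that)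
    show "wx (0, t) * \<psi> (0, t) = 0 \<and> wx (L, t) * \<psi> (L, t) = 0" if "t \<in> {0<..<\<tau>}" for t
      using neumann[OF that] by (simp add: wx_def)
    fix p assume p: "p \<in> Q L \<tau>"
    obtain x t where xt: "p = (x, t)" by (cases p)
    have "dt \<psi> p = \<psi>t p" "dx \<psi> p = \<psi>x p"
      using dt_eq[OF p, of \<psi> "\<psi>t p"] dx_eq[OF p, of \<psi> "\<psi>x p"] \<psi>x[of x t] \<psi>t[of x t] Q_R[OF p]
      by (simp_all add: xt)
    then show "u p * dt \<psi> p - wx p * dx \<psi> p =
        (ut p * \<psi> p + \<psi>t p * u p) - (wxx p * \<psi> p + \<psi>x p * wx p) + (wxx p - ut p) * \<psi> p"
      by (simp add: algebra_simps)
  qed (intro continuous_intros L \<tau> c cont_u cont_w_partials cont_partials)+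
  also have "(LINT p|lebesgue_on (Q L \<tau>). (wxx p - ut p) * \<psi> p) = (LINT p|lebesgue_on (Q L \<tau>). 0)"
    using wxx_eq_ut by (intro Bochner_Integration.integral_cong) (auto simp: space_restrict_space)
  also have "(LINT x|lebesgue_on {0<..<L}. u (x, \<tau>) * \<psi> (x, \<tau>) - u (x, 0) * \<psi> (x, 0)) =
      (LINT x|lebesgue_on {0<..<L}. - (u (x, 0) * \<psi> (x, 0)))"
    using assms(2) by (intro Bochner_Integration.integral_cong) (auto simp: space_restrict_space)
  finally show ?thesis by simp
qed

text \<open>The integral equals that of \<open>(g (w p) * wxx p - Gst p) * \<psi> p\<close>, all
  boundary terms vanishing with \<open>\<psi>\<close>. It remains to show that this production is
  nonnegative.\<close>

lemma entropy_inequality: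
  assumes g: "C_on 1 UNIV g" "\<forall>s. 0 \<le> deriv g s"
    and \<psi>: "test_function (Q L \<tau>) \<psi>" "\<forall>p. 0 \<le> \<psi> p"
  shows "0 \<le> (LINT p|lebesgue_on (Q L \<tau>).
                entropy_G_star N g K (\<lambda>p. 1 - l p) (\<lambda>p. 0) l w p * dt \<psi> p
                - g (w p) * wx p * dx \<psi> p - deriv g (w p) * (wx p)\<^sup>2 * \<psi> p)"
proof -
  note dg = C_on_real_derivative[OF g(1)]
  have cg: "continuous_on UNIV g" using C_on_imp_continuous_on[OF g(1)] .
  have mono: "mono g" using DERIV_nonneg_imp_nondecreasing[of _ _ g] dg(1) g(2) by (metis monoI)
  let ?G = "entropy_G N g K"
  note dG = entropy_G_derivative[OF adm cg, of K]
  have cG: "continuous_on UNIV ?G" using DERIV_continuous_on[of UNIV ?G "\<lambda>s. g (phi N s)"] dG by simp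
  have "C_on 1 UNIV \<psi>" using \<psi>(1) unfolding test_function_def by blast
  from C_on_subset[OF this subset_UNIV] have C\<psi>: "C_on 1 R \<psi>" .
  obtain \<psi>x \<psi>t where c\<psi>': "C_on 0 R \<psi>x" "C_on 0 R \<psi>t"
    and \<psi>x: "\<And>x t. x \<in> {0..L} \<Longrightarrow> t \<in> {0..\<tau>} \<Longrightarrow>
      ((\<lambda>x. \<psi> (x, t)) has_real_derivative \<psi>x (x, t)) (at x within {0..L})"
    and \<psi>t: "\<And>x t. x \<in> {0..L} \<Longrightarrow> t \<in> {0..\<tau>} \<Longrightarrow>
      ((\<lambda>t. \<psi> (x, t)) has_real_derivative \<psi>t (x, t)) (at t within {0..\<tau>})"
    using C_on_partials[of 0 "{0..L}" "{0..\<tau>}" \<psi>] C\<psi> unfolding One_nat_def by metis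
  have c: "continuous_on R \<psi>" "continuous_on R \<psi>x" "continuous_on R \<psi>t"
    using c\<psi>' C_on_imp_continuous_on[OF C\<psi>] by auto
  \<comment> \<open>Affine expressions that agree with \<open>beta0 N (w p)\<close> and
    \<open>beta2 N (w p)\<close> on \<open>R\<close> and can be differentiated directly.\<close>
  define b0 b2 where "b0 p = turn_c N - kappa N * (w p - level_A N)"
    and "b2 p = turn_c N + (w p - level_A N) / slope2 N" for p
  define b0t b2t where "b0t p = - kappa N * wt p" and "b2t p = wt p / slope2 N" for p
  define Gs where "Gs p = (1 - l p) * ?G (b0 p) + l p * ?G (b2 p)" for p
  \<comment> \<open>The time derivative of \<open>Gs\<close>. Since \<open>phi N\<close> equals
    \<open>w\<close> at both \<open>b0\<close> and \<open>b2\<close>, the two chain-rule terms share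
    the factor \<open>g (w p)\<close>.\<close>
  define Gst where "Gst p = lt p * (?G (b2 p) - ?G (b0 p)) +
      g (w p) * ((1 - l p) * b0t p + l p * b2t p)" for p
  have phi_b: "phi N (b0 p) = w p" "phi N (b2 p) = w p" if "p \<in> R" for p
  proof -
    have "kappa N * (w p - level_A N) \<le> kappa N * (level_B N - level_A N)"
      using w_range[OF that] kappa by (intro mult_left_mono) auto
    also have "\<dots> = turn_c N - turn_b N" using adm by (simp add: kappa_def admissible_def)
    finally show "phi N (b0 p) = w p"
      using phi_middle[OF adm, of "b0 p"] kappa w_range[OF that] by (simp add: b0_def)
    show "phi N (b2 p) = w p"
      using phi_right[OF adm, of "b2 p"] slope2 w_range[OF that] by (simp add: b2_def)
  qed
  have b0t: "((\<lambda>t. b0 (x, t)) has_real_derivative b0t (x, t)) (at t within {0..\<tau>})"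
    and b2t: "((\<lambda>t. b2 (x, t)) has_real_derivative b2t (x, t)) (at t within {0..\<tau>})"
    if "x \<in> {0..L}" "t \<in> {0..\<tau>}" for x t
    unfolding b0_def b2_def b0t_def b2t_def using slope2
    by (auto intro!: derivative_eq_intros wt[OF that])
  have cb: "continuous_on R b0" "continuous_on R b2" "continuous_on R b0t" "continuous_on R b2t"
    unfolding b0_def[abs_def] b2_def[abs_def] b0t_def[abs_def] b2t_def[abs_def]
    using slope2 by (intro continuous_intros cont_w cont_w_partials; simp)+
  have cGb: "continuous_on R (\<lambda>p. ?G (b0 p))" "continuous_on R (\<lambda>p. ?G (b2 p))"
    using continuous_on_compose2[OF cG cb(1) subset_UNIV] continuous_on_compose2[OF cG cb(2) subset_UNIV] .
  have cgw: "continuous_on R (\<lambda>p. g (w p))" "continuous_on R (\<lambda>p. deriv g (w p))"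
    using continuous_on_compose2[OF cg cont_w subset_UNIV] continuous_on_compose2[OF dg(2) cont_w subset_UNIV] .
  have cGs: "continuous_on R Gs" "continuous_on R Gst"
    unfolding Gs_def[abs_def] Gst_def[abs_def]
    by (intro continuous_intros cGb cgw cb cont_l cont_lt)+
  have Gst: "((\<lambda>t. Gs (x, t)) has_real_derivative Gst (x, t)) (at t within {0..\<tau>})"
    if xt: "x \<in> {0..L}" "t \<in> {0..\<tau>}" for x t
  proof -
    have p: "(x, t) \<in> R" using xt by auto
    have "((\<lambda>t. ?G (b0 (x, t))) has_real_derivative g (w (x, t)) * b0t (x, t)) (at t within {0..\<tau>})"
      "((\<lambda>t. ?G (b2 (x, t))) has_real_derivative g (w (x, t)) * b2t (x, t)) (at t within {0..\<tau>})"
      using DERIV_chain2[OF dG b0t[OF xt]] DERIV_chain2[OF dG b2t[OF xt]] phi_b[OF p] by simp_all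
    from DERIV_add[OF DERIV_mult[OF DERIV_diff[OF DERIV_const[of 1] lt[OF xt]] this(1)]
        DERIV_mult[OF lt[OF xt] this(2)]]
    show ?thesis unfolding Gs_def Gst_def by (rule DERIV_cong) (simp add: algebra_simps)
  qed
  have Gst_le: "Gst p \<le> g (w p) * wxx p" if p: "p \<in> Q L \<tau>" for p
  proof -
    note pR = Q_R[OF p]
    obtain x t where xt: "p = (x, t)" by (cases p)
    have m: "x \<in> {0..L}" "t \<in> {0..\<tau>}" using pR xt by auto
    \<comment> \<open>The derivative of the mixture is computed twice, as that of \<open>u\<close>
      and by the product rule. Comparison splits \<open>ut\<close> into a transfer term with
      \<open>lt\<close> and a drift term; the drift cancels against the one in \<open>Gst\<close>,
      and the transfer terms are compared by \<open>entropy_G_increment_le\<close>.\<close>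
    have "((\<lambda>t. (1 - l (x, t)) * b0 (x, t) + l (x, t) * b2 (x, t)) has_real_derivative ut (x, t))
        (at t within {0..\<tau>})"
    proof (rule has_field_derivative_transform_within[OF ut[OF m] zero_less_one m(2)])
      fix s assume "s \<in> {0..\<tau>}"
      then show "u (x, s) = (1 - l (x, s)) * b0 (x, s) + l (x, s) * b2 (x, s)"
        using u_mixture[of "(x, s)"] beta_w[of "(x, s)"] m by (simp add: b0_def b2_def)
    qed
    moreover have "((\<lambda>t. (1 - l (x, t)) * b0 (x, t) + l (x, t) * b2 (x, t)) has_real_derivative
        ((0 - lt (x, t)) * b0 (x, t) + b0t (x, t) * (1 - l (x, t))) +
        (lt (x, t) * b2 (x, t) + b2t (x, t) * l (x, t))) (at t within {0..\<tau>})"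
      by (intro DERIV_add DERIV_mult DERIV_diff DERIV_const lt b0t b2t m)
    moreover have "at t within {0..\<tau>} = at t" using p xt by (simp add: Q_def at_within_Icc_at)
    ultimately have "ut p = ((0 - lt p) * b0 p + b0t p * (1 - l p)) + (lt p * b2 p + b2t p * l p)"
      unfolding xt using DERIV_unique by simp
    then have e: "ut p = lt p * (b2 p - b0 p) + ((1 - l p) * b0t p + l p * b2t p)"
      by (simp add: algebra_simps)
    have "b2 p - b0 p = rate N * (w p - level_A N)"
      by (simp add: b0_def b2_def rate_def distrib_right)
    then have "?G (b2 p) - ?G (b0 p) \<le> g (w p) * (b2 p - b0 p)"
      using entropy_G_increment_le[OF adm cg mono, of "w p" K] w_range[OF pR]
      by (simp add: b0_def b2_def)
    from mult_left_mono[OF this lt_nonneg[OF pR]]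
    show ?thesis unfolding wxx_eq_ut[OF p] e Gst_def by (simp add: algebra_simps)
  qed
  have \<psi>0: "\<psi> p = 0" if "p \<notin> Q L \<tau>" for p using test_function_zero[OF \<psi>(1) that] .
  have "(LINT p|lebesgue_on (Q L \<tau>).
          entropy_G_star N g K (\<lambda>p. 1 - l p) (\<lambda>p. 0) l w p * dt \<psi> p
          - g (w p) * wx p * dx \<psi> p - deriv g (w p) * (wx p)\<^sup>2 * \<psi> p) =
      (LINT x|lebesgue_on {0<..<L}. Gs (x, \<tau>) * \<psi> (x, \<tau>) - Gs (x, 0) * \<psi> (x, 0)) +
      (LINT p|lebesgue_on (Q L \<tau>). (g (w p) * wxx p - Gst p) * \<psi> p)"
  proof (rule integral_divergence[where F = "\<lambda>p. Gs p * \<psi> p" and Ft = "\<lambda>p. Gst p * \<psi> p + \<psi>t p * Gs p"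
        and H = "\<lambda>p. g (w p) * wx p * \<psi> p"
        and Hx = "\<lambda>p. (deriv g (w p) * wx p * wx p + wxx p * g (w p)) * \<psi> p + \<psi>x p * (g (w p) * wx p)"])
    show "((\<lambda>t. Gs (x, t) * \<psi> (x, t)) has_real_derivative
        Gst (x, t) * \<psi> (x, t) + \<psi>t (x, t) * Gs (x, t)) (at t within {0..\<tau>})"
      if "x \<in> {0..L}" "t \<in> {0..\<tau>}" for x t by (intro DERIV_mult Gst \<psi>t that)
    show "((\<lambda>x. g (w (x, t)) * wx (x, t) * \<psi> (x, t)) has_real_derivative
        (deriv g (w (x, t)) * wx (x, t) * wx (x, t) + wxx (x, t) * g (w (x, t))) * \<psi> (x, t) +
        \<psi>x (x, t) * (g (w (x, t)) * wx (x, t))) (at x within {0..L})"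
      if xt: "x \<in> {0..L}" "t \<in> {0..\<tau>}" for x t
      by (intro DERIV_mult wxx \<psi>x DERIV_chain2[OF dg(1) wx] xt)
    show "g (w (0, t)) * wx (0, t) * \<psi> (0, t) = 0 \<and> g (w (L, t)) * wx (L, t) * \<psi> (L, t) = 0"
      if "t \<in> {0<..<\<tau>}" for t using \<psi>0 by (simp add: Q_def)
    fix p assume p: "p \<in> Q L \<tau>"
    obtain x t where xt: "p = (x, t)" by (cases p)
    have "dt \<psi> p = \<psi>t p" "dx \<psi> p = \<psi>x p"
      using dt_eq[OF p, of \<psi> "\<psi>t p"] dx_eq[OF p, of \<psi> "\<psi>x p"] \<psi>x[of x t] \<psi>t[of x t] Q_R[OF p]
      by (simp_all add: xt)
    moreover have "entropy_G_star N g K (\<lambda>p. 1 - l p) (\<lambda>p. 0) l w p = Gs p"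
      unfolding entropy_G_star_def Gs_def b0_def b2_def using beta_w[OF Q_R[OF p]] by simp
    ultimately show "entropy_G_star N g K (\<lambda>p. 1 - l p) (\<lambda>p. 0) l w p * dt \<psi> p
        - g (w p) * wx p * dx \<psi> p - deriv g (w p) * (wx p)\<^sup>2 * \<psi> p =
        (Gst p * \<psi> p + \<psi>t p * Gs p)
        - ((deriv g (w p) * wx p * wx p + wxx p * g (w p)) * \<psi> p + \<psi>x p * (g (w p) * wx p))
        + (g (w p) * wxx p - Gst p) * \<psi> p"
      by (simp add: algebra_simps power2_eq_square)
  qed (intro continuous_intros L \<tau> c cGs cgw cont_w_partials)+
  also have "\<dots> = (LINT p|lebesgue_on (Q L \<tau>). (g (w p) * wxx p - Gst p) * \<psi> p)"
    using \<psi>0 by (simp add: Q_def)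
  also have "0 \<le> \<dots>"
    using Gst_le \<psi>(2)
    by (intro Bochner_Integration.integral_nonneg mult_nonneg_nonneg) (auto simp: space_restrict_space)
  finally show ?thesis .
qed

lemma entropy: "entropy_solution N L \<tau> (\<lambda>x. u (x, 0)) u (\<lambda>p. 1 - l p) (\<lambda>p. 0) l w"
  unfolding entropy_solution_def
proof (intro conjI exI[of _ wx] allI impI)
  show "L_infinity (Q L \<tau>) u" "L_infinity (Q L \<tau>) (\<lambda>p. 1 - l p)" "L_infinity (Q L \<tau>) (\<lambda>p. 0)"
    "L_infinity (Q L \<tau>) l" "L_infinity (Q L \<tau>) w"
    by (intro L_infinity_continuous continuous_intros cont_u cont_l cont_w)+
  show "AE p in lebesgue_on (Q L \<tau>). 0 \<le> 1 - l p \<and> 0 \<le> (0::real) \<and> 0 \<le> l p \<and> 1 - l p + 0 + l p = 1 \<and>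
      u p = (1 - l p) * beta0 N (w p) + 0 * beta1 N (w p) + l p * beta2 N (w p) \<and>
      (w p < level_A N \<longrightarrow> 0 = (1::real)) \<and> (w p > level_B N \<longrightarrow> l p = 1)"
  proof (rule AE_I2)
    fix p assume "p \<in> space (lebesgue_on (Q L \<tau>))"
    then have p: "p \<in> R" using Q_R by (simp add: space_restrict_space)
    show "0 \<le> 1 - l p \<and> 0 \<le> (0::real) \<and> 0 \<le> l p \<and> 1 - l p + 0 + l p = 1 \<and>
      u p = (1 - l p) * beta0 N (w p) + 0 * beta1 N (w p) + l p * beta2 N (w p) \<and>
      (w p < level_A N \<longrightarrow> 0 = (1::real)) \<and> (w p > level_B N \<longrightarrow> l p = 1)"
      using l_range[OF p] w_range[OF p] u_mixture[OF p] by simp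
  qed
  show "L2_H1_with_deriv L \<tau> w wx"
    using L2_H1_with_deriv_classical[OF L cont_w cont_w_partials(1) wx] .
qed (use weak_formulation entropy_inequality in auto)

end

section \<open>Choice of the time horizon and the one-parameter family\<close>

theorem mainTheorem1:
  fixes N :: nonlinearity and L T b' c' :: real
    and g :: "real \<Rightarrow> real" and ubar :: "real \<times> real \<Rightarrow> real"
  assumes "0 < L" and "admissible N" and "0 < T"
    and "turn_b N < b'" and "b' < c'" and "c' < turn_c N"
    and "C_on 1 {0..L} g"
    and "(g has_real_derivative 0) (at 0 within {0..L})"
    and "(g has_real_derivative 0) (at L within {0..L})"
    and "\<forall>x\<in>{0..L}. g x \<in> {b'<..<c'}"
    and "final_value_solution N L T g ubar"
    and "\<forall>p\<in>{0..L} \<times> {0..T}. ubar p \<in> {b'<..<c'}"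
  shows "\<exists>Tbar. 0 < Tbar \<and> Tbar \<le> T \<and>
    (\<exists>S. infinite S \<and>
       pairwise (\<lambda>(u, l, v) (u', l', v').
         \<exists>p\<in>Q L Tbar. u p \<noteq> u' p \<or> l p \<noteq> l' p \<or> v p \<noteq> v' p) S \<and>
       (ubar, (\<lambda>p. 0), (\<lambda>p. phi N (ubar p))) \<in> S \<and>
       (\<forall>(u, l, v)\<in>S.
          two_phase_regular_solution N L Tbar (\<lambda>x. ubar (x, 0)) u l v \<and>
          (\<forall>x\<in>{0<..<L}. l (x, 0) = 0) \<and>
          entropy_solution N L Tbar (\<lambda>x. ubar (x, 0)) u (\<lambda>p. 1 - l p) (\<lambda>p. 0) l v)) \<and>
    (\<exists>u l0 l1 l2 v u' l0' l1' l2' v'.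
       entropy_solution N L Tbar (\<lambda>x. ubar (x, 0)) u l0 l1 l2 v \<and>
       entropy_solution N L Tbar (\<lambda>x. ubar (x, 0)) u' l0' l1' l2' v' \<and>
       \<not> (AE p in lebesgue_on (Q L Tbar).
            u p = u' p \<and> l0 p = l0' p \<and> l1 p = l1' p \<and> l2 p = l2' p \<and> v p = v' p))"
proof -
  \<comment> \<open>The solution is only of class \<open>C\<^sup>2\<close> before the final time; on
    the half interval it is so up to the boundary of a compact rectangle, and \<open>ut\<close> is
    bounded.\<close>
  define R1 where "R1 = {0..L} \<times> {0..T / 2}"
  have fv: "C_on 2 ({0..L} \<times> {0..<T}) ubar"
    "\<And>p. p \<in> Q L T \<Longrightarrow> dt ubar p = dx (dx (\<lambda>q. phi N (ubar q))) p"
    "\<And>t. t \<in> {0<..<T} \<Longrightarrow> ((\<lambda>x. ubar (x, t)) has_real_derivative 0) (at 0 within {0..L})"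
    "\<And>t. t \<in> {0<..<T} \<Longrightarrow> ((\<lambda>x. ubar (x, t)) has_real_derivative 0) (at L within {0..L})"
    using assms(11) unfolding final_value_solution_def by blast+
  have C2: "C_on 2 R1 ubar" using assms(3) by (intro C_on_subset[OF fv(1)]) (auto simp: R1_def)
  then obtain ux ut where C1: "C_on 1 R1 ux" "C_on 1 R1 ut"
    and ux: "\<And>x t. x \<in> {0..L} \<Longrightarrow> t \<in> {0..T / 2} \<Longrightarrow>
      ((\<lambda>x. ubar (x, t)) has_real_derivative ux (x, t)) (at x within {0..L})"
    and ut: "\<And>x t. x \<in> {0..L} \<Longrightarrow> t \<in> {0..T / 2} \<Longrightarrow>
      ((\<lambda>t. ubar (x, t)) has_real_derivative ut (x, t)) (at t within {0..T / 2})"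
    using C_on_partials[of 1 "{0..L}" "{0..T / 2}" ubar] unfolding R1_def Suc_1 by metis
  obtain uxx where C0: "C_on 0 R1 uxx"
    and uxx: "\<And>x t. x \<in> {0..L} \<Longrightarrow> t \<in> {0..T / 2} \<Longrightarrow>
      ((\<lambda>x. ux (x, t)) has_real_derivative uxx (x, t)) (at x within {0..L})"
    using C_on_partials[of 0 "{0..L}" "{0..T / 2}" ux] C1(1) unfolding R1_def One_nat_def by metis
  have cont: "continuous_on R1 ux" "continuous_on R1 ut" "continuous_on R1 uxx"
    using C1[THEN C_on_imp_continuous_on] C0[THEN C_on_imp_continuous_on] by auto
  have "bounded (ut ` R1)"
    by (intro compact_imp_bounded compact_continuous_image cont) (simp add: R1_def compact_Times)
  then obtain M where M: "0 < M" "\<And>p. p \<in> R1 \<Longrightarrow> \<bar>ut p\<bar> \<le> M"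
    unfolding bounded_pos by auto
  have k: "0 < kappa N" using kappa_pos assms(2) .
  \<comment> \<open>The three terms keep the rectangle inside \<open>R1\<close>, give
    \<open>small_c\<close> through the bound \<open>M\<close> on \<open>ut\<close>, and give
    \<open>small_b\<close>. One \<open>Tbar\<close> thus serves every \<open>\<epsilon>\<close> in
    \<open>{0..1}\<close>.\<close>
  define Tbar where "Tbar = min (T / 2) (min ((turn_c N - c') / M) ((b' - turn_b N) / kappa N))"
  have "0 < Tbar" using assms(3,4,6) M(1) k by (simp add: Tbar_def)
  moreover have "Tbar \<le> T / 2" "Tbar \<le> (turn_c N - c') / M" "Tbar \<le> (b' - turn_b N) / kappa N"
    unfolding Tbar_def by linarith+
  ultimately have Tbar: "0 < Tbar" "Tbar \<le> T / 2" "Tbar \<le> (turn_c N - c') / M"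
    "Tbar \<le> (b' - turn_b N) / kappa N" by auto
  have sub: "{0..L} \<times> {0..Tbar} \<subseteq> R1" using Tbar(2) by (auto simp: R1_def)
  have range_u: "b' < ubar p" "ubar p < c'" if "p \<in> {0..L} \<times> {0..Tbar}" for p
  proof -
    have "p \<in> {0..L} \<times> {0..T}" using that Tbar(2) assms(3) by auto
    then have "ubar p \<in> {b'<..<c'}" using assms(12) by blast
    then show "b' < ubar p" "ubar p < c'" by auto
  qed
  have flow: "unstable_flow N L Tbar \<epsilon> ubar ux ut uxx" if "\<epsilon> \<in> {0..1}" for \<epsilon>
  proof
    show "admissible N" "0 < L" "0 < Tbar" "0 \<le> \<epsilon>" "\<epsilon> \<le> 1" using assms Tbar that by auto
    show "C_on 2 ({0..L} \<times> {0..Tbar}) ubar" using C_on_subset[OF C2 sub] .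
    show "continuous_on ({0..L} \<times> {0..Tbar}) ux" "continuous_on ({0..L} \<times> {0..Tbar}) ut"
      "continuous_on ({0..L} \<times> {0..Tbar}) uxx"
      using cont[THEN continuous_on_subset[OF _ sub]] by auto
    fix x t assume x: "x \<in> {0..L}" and "t \<in> {0..Tbar}"
    then have t: "t \<in> {0..T / 2}" using Tbar(2) by auto
    show "((\<lambda>x. ubar (x, t)) has_real_derivative ux (x, t)) (at x within {0..L})"
      "((\<lambda>x. ux (x, t)) has_real_derivative uxx (x, t)) (at x within {0..L})"
      using ux[OF x t] uxx[OF x t] .
    show "((\<lambda>t. ubar (x, t)) has_real_derivative ut (x, t)) (at t within {0..Tbar})"
      using Tbar(2) by (intro DERIV_subset[OF ut[OF x t]]) auto
  next
    fix t assume t: "t \<in> {0<..<Tbar}"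
    \<comment> \<open>One-sided derivatives are unique at the end points because these are limit
      points of the interval; hence \<open>ux\<close> has the prescribed boundary values.\<close>
    have "at 0 within {0..L} \<noteq> bot" "at L within {0..L} \<noteq> bot"
      using assms(1) by (simp_all add: at_within_Icc_at_right at_within_Icc_at_left)
    then show "ux (0, t) = 0 \<and> ux (L, t) = 0"
      using has_field_derivative_unique[OF ux[of 0 t] fv(3)[of t]]
        has_field_derivative_unique[OF ux[of L t] fv(4)[of t]] t Tbar(2) assms(1,3) by auto
  next
    fix p assume p: "p \<in> Q L Tbar"
    obtain x t where xt: "p = (x, t)" by (cases p)
    have pT: "p \<in> Q L T" "p \<in> Q L (T / 2)" using p Tbar(2) assms(3) by (auto simp: Q_def)
    have "ut p = dt ubar p"
      using dt_eq[OF pT(2), of ubar "ut p"] ut[of x t] pT(2) by (simp add: xt Q_def)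
    also have "\<dots> = dx (dx (\<lambda>q. phi N (ubar q))) p" using fv(2)[OF pT(1)] .
    also have "\<dots> = - uxx p / kappa N"
    proof (rule dx_dx_eq[OF p])
      fix y s assume ys: "y \<in> {0..L}" "s \<in> {0..Tbar}"
      then have s: "s \<in> {0..T / 2}" using Tbar(2) by auto
      show "((\<lambda>x. - ux (x, s) / kappa N) has_real_derivative - uxx (y, s) / kappa N) (at y within {0..L})"
        using k by (auto intro!: derivative_eq_intros uxx[OF ys(1) s])
      show "((\<lambda>x. phi N (ubar (x, s))) has_real_derivative - ux (y, s) / kappa N) (at y within {0..L})"
      proof (rule has_field_derivative_transform_within[OF _ zero_less_one ys(1)])
        show "((\<lambda>x. level_A N + (turn_c N - ubar (x, s)) / kappa N) has_real_derivative
            - ux (y, s) / kappa N) (at y within {0..L})"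
          using k by (auto intro!: derivative_eq_intros ux[OF ys(1) s])
        show "level_A N + (turn_c N - ubar (z, s)) / kappa N = phi N (ubar (z, s))" if "z \<in> {0..L}" for z
          using range_u[of "(z, s)"] that ys(2) assms(4,6) by (intro phi_middle[symmetric] assms) auto
      qed
    qed
    finally show "ut p = - uxx p / kappa N" .
  next
    fix p assume p: "p \<in> {0..L} \<times> {0..Tbar}"
    show "turn_b N < ubar p \<and> ubar p < turn_c N" using range_u[OF p] assms(4,6) by auto
    have "Tbar * \<bar>ut p\<bar> \<le> Tbar * M" using M(2) p sub Tbar(1) by (intro mult_left_mono) auto
    also have "\<dots> \<le> turn_c N - c'" using Tbar(3) M(1) by (simp add: field_simps)
    finally show "Tbar * \<bar>ut p\<bar> \<le> turn_c N - ubar p" using range_u[OF p] by simp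
    have "kappa N * Tbar \<le> b' - turn_b N" using Tbar(4) k by (simp add: field_simps)
    then show "kappa N * Tbar \<le> ubar p - turn_b N" using range_u[OF p] by simp
  qed
  let ?l = "stable_fraction N ubar" and ?v = "raised_flux N ubar"
  \<comment> \<open>Two fluxes differ by the nonzero amount
    \<open>(\<epsilon> - \<epsilon>') * snd p\<close> at every point of the open rectangle. A single
    point gives injectivity and pairwise difference; the whole rectangle is needed for the failure
    of equality almost everywhere.\<close>
  have v_neq: "?v \<epsilon> p \<noteq> ?v \<epsilon>' p" if "\<epsilon> \<noteq> \<epsilon>'" "p \<in> Q L Tbar" for \<epsilon> \<epsilon>' p
    using that by (auto simp: raised_flux_def Q_def)
  have Q_pt: "(L / 2, Tbar / 2) \<in> Q L Tbar" using assms(1) Tbar(1) by (simp add: Q_def)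
  define S where "S = (\<lambda>\<epsilon>. (ubar, ?l \<epsilon>, ?v \<epsilon>)) ` {0..1}"
  have "inj_on (\<lambda>\<epsilon>. (ubar, ?l \<epsilon>, ?v \<epsilon>)) {0..1}"
  proof (rule inj_onI)
    fix \<epsilon> \<epsilon>' assume "(ubar, ?l \<epsilon>, ?v \<epsilon>) = (ubar, ?l \<epsilon>', ?v \<epsilon>')"
    then show "\<epsilon> = \<epsilon>'" using v_neq[OF _ Q_pt, of \<epsilon> \<epsilon>'] by auto
  qed
  then have "infinite S" unfolding S_def using finite_imageD infinite_Icc[of 0 "1::real"] by fastforce
  moreover have "pairwise (\<lambda>(u, l, v) (u', l', v').
      \<exists>p\<in>Q L Tbar. u p \<noteq> u' p \<or> l p \<noteq> l' p \<or> v p \<noteq> v' p) S"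
  proof (rule pairwiseI)
    fix s s' assume "s \<in> S" "s' \<in> S" "s \<noteq> s'"
    then obtain \<epsilon> \<epsilon>' where "s = (ubar, ?l \<epsilon>, ?v \<epsilon>)" "s' = (ubar, ?l \<epsilon>', ?v \<epsilon>')" "\<epsilon> \<noteq> \<epsilon>'"
      unfolding S_def by blast
    then show "(case s of (u, l, v) \<Rightarrow> \<lambda>(u', l', v').
        \<exists>p\<in>Q L Tbar. u p \<noteq> u' p \<or> l p \<noteq> l' p \<or> v p \<noteq> v' p) s'"
      using v_neq[OF _ Q_pt, of \<epsilon> \<epsilon>'] Q_pt by auto
  qed
  moreover have "(ubar, (\<lambda>p. 0), (\<lambda>p. phi N (ubar p))) \<in> S"
    \<comment> \<open>The parameter 0 leaves the flux unraised and the stable fraction zero.\<close>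
    unfolding S_def by (rule image_eqI[of _ _ 0]) (auto simp: stable_fraction_def raised_flux_def)
  moreover have "\<forall>(u, l, v)\<in>S.
      two_phase_regular_solution N L Tbar (\<lambda>x. ubar (x, 0)) u l v \<and>
      (\<forall>x\<in>{0<..<L}. l (x, 0) = 0) \<and>
      entropy_solution N L Tbar (\<lambda>x. ubar (x, 0)) u (\<lambda>p. 1 - l p) (\<lambda>p. 0) l v"
    using unstable_flow.two_phase[OF flow] unstable_flow.entropy[OF flow]
    by (auto simp: S_def stable_fraction_def)
  moreover have "entropy_solution N L Tbar (\<lambda>x. ubar (x, 0)) ubar (\<lambda>p. 1 - ?l 0 p) (\<lambda>p. 0) (?l 0) (?v 0)"
    "entropy_solution N L Tbar (\<lambda>x. ubar (x, 0)) ubar (\<lambda>p. 1 - ?l 1 p) (\<lambda>p. 0) (?l 1) (?v 1)"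
    using unstable_flow.entropy[OF flow] by auto
  moreover have "\<not> (AE p in lebesgue_on (Q L Tbar). ubar p = ubar p \<and> 1 - ?l 0 p = 1 - ?l 1 p \<and>
      0 = (0::real) \<and> ?l 0 p = ?l 1 p \<and> ?v 0 p = ?v 1 p)"
  proof
    assume "AE p in lebesgue_on (Q L Tbar). ubar p = ubar p \<and> 1 - ?l 0 p = 1 - ?l 1 p \<and>
      0 = (0::real) \<and> ?l 0 p = ?l 1 p \<and> ?v 0 p = ?v 1 p"
    \<comment> \<open>Since the fluxes for 0 and 1 differ everywhere, equality almost everywhere
      would make the nonempty open rectangle a null set.\<close>
    then have "AE p in lebesgue_on (Q L Tbar). \<not> True"
      by (rule AE_mp) (intro AE_I2 impI, use v_neq[of 0 1] in \<open>auto simp: space_restrict_space\<close>)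
    from emeasure_eq_0_AE[OF this] have "emeasure lebesgue (Q L Tbar) = 0"
      by (simp add: space_restrict_space emeasure_restrict_space)
    then have "negligible (Q L Tbar)" by (simp add: negligible_iff_emeasure0)
    moreover have "open (Q L Tbar)" unfolding Q_eq_box by (rule open_box)
    ultimately show False using open_not_negligible Q_pt by blast
  qed
  moreover have "Tbar \<le> T" using Tbar(2) assms(3) by simp
  ultimately show ?thesis using Tbar(1) by blast
qed

end
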